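(* Let $\alpha\in(1,2)$, let $a:\mathbb{R}\to(0,\infty)$ be continuous with $\int_{\mathbb{R}}a(x)^{-1}\mathrm{d}x=1$, and let $\mu(\mathrm{d}x)=a(x)^{-1}\mathrm{d}x$. Let $(\mathscr{E},\mathscr{F})$ be the Dirichlet form of the time-changed symmetric $\alpha$-stable process $Y$ with generator $a(x)\Delta^{\alpha/2}$. Let $\epsilon>2$. Then the Nash inequality with parameter $\epsilon$ holds, i.e. there is a constant $A_N>0$ such that $$\|f-\mu(f)\|_{L^2(\mu)}^{2+4/\epsilon}\leqslant A_N^{-1}\,\mathscr{E}(f,f)\,\|f\|_{L^1(\mu)}^{4/\epsilon}\quad\text{for all }f\in\mathscr{F},$$ if and only if $$\sup_{x\in\mathbb{R}}\left\{|x|^{\alpha-1}\mu\big((-|x|,|x|)^c\big)^{(\epsilon-2)/\epsilon}\right\}<\infty.$$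
   Context: The Dirichlet form of $Y$ is $$\mathscr{E}(f,g)=\frac12\int_{\mathbb{R}}\int_{\mathbb{R}}(f(x)-f(y))(g(x)-g(y))\frac{C_\alpha\,\mathrm{d}x\,\mathrm{d}y}{|x-y|^{1+\alpha}},\qquad \mathscr{F}=\{f\in L^2(\mu):\mathscr{E}(f,f)<\infty\},$$ with $C_\alpha=\frac{\alpha2^{\alpha-1}\Gamma((\alpha+1)/2)}{\pi^{1/2}\Gamma(1-\alpha/2)}$. Here $\mu(f)=\int f\,\mathrm{d}\mu$ and $A^c=\mathbb{R}\setminus A$. *)

theory Defs
  imports "HOL-Analysis.Analysis"
begin

definition stable_const :: "real \<Rightarrow> real" where
  "stable_const \<alpha> =
     \<alpha> * 2 powr (\<alpha> - 1) * Gamma ((\<alpha> + 1) / 2) / (pi powr (1 / 2) * Gamma (1 - \<alpha> / 2))"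

definition speed_measure :: "(real \<Rightarrow> real) \<Rightarrow> real measure" where
  "speed_measure a = density lborel (\<lambda>x. ennreal (1 / a x))"

text \<open>The integrand of the form. On the diagonal it is 0, both by the increments of f and g and by
  the convention that division by 0 yields 0.\<close>

definition stable_integrand :: "real \<Rightarrow> (real \<Rightarrow> real) \<Rightarrow> (real \<Rightarrow> real) \<Rightarrow> real \<Rightarrow> real \<Rightarrow> real" where
  "stable_integrand \<alpha> f g x y =
     (f x - f y) * (g x - g y) * (stable_const \<alpha> / \<bar>x - y\<bar> powr (1 + \<alpha>))"

definition dirichlet_form :: "real \<Rightarrow> (real \<Rightarrow> real) \<Rightarrow> (real \<Rightarrow> real) \<Rightarrow> real" where
  "dirichlet_form \<alpha> f g = 1 / 2 * (\<integral>x. (\<integral>y. stable_integrand \<alpha> f g x y \<partial>lborel) \<partial>lborel)"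

text \<open>The Bochner integral above is 0 for non-integrable functions, so finiteness of the energy in
  the domain has to be stated with the extended nonnegative integral. On the domain the two notions
  agree, see the lemma at the end.\<close>

definition stable_energy :: "real \<Rightarrow> (real \<Rightarrow> real) \<Rightarrow> ennreal" where
  "stable_energy \<alpha> f =
     1 / 2 * (\<integral>\<^sup>+x. (\<integral>\<^sup>+y. ennreal (stable_integrand \<alpha> f f x y) \<partial>lborel) \<partial>lborel)"

text \<open>Elements of the Lebesgue spaces are represented by Borel functions.\<close>

definition dirichlet_domain :: "real \<Rightarrow> real measure \<Rightarrow> (real \<Rightarrow> real) set" where
  "dirichlet_domain \<alpha> \<mu> =
     {f \<in> borel_measurable \<mu>. integrable \<mu> (\<lambda>x. (f x)\<^sup>2) \<and> stable_energy \<alpha> f < \<infinity>}"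

definition Lp_norm :: "real \<Rightarrow> 'a measure \<Rightarrow> ('a \<Rightarrow> real) \<Rightarrow> real" where
  "Lp_norm p M f = (\<integral>x. \<bar>f x\<bar> powr p \<partial>M) powr (1 / p)"

definition nash_inequality ::
    "real \<Rightarrow> 'a measure \<Rightarrow> (('a \<Rightarrow> real) \<Rightarrow> ('a \<Rightarrow> real) \<Rightarrow> real) \<Rightarrow> ('a \<Rightarrow> real) set \<Rightarrow> bool" where
  "nash_inequality \<epsilon> \<mu> E F \<longleftrightarrow>
     (\<exists>A>0. \<forall>f\<in>F.
        Lp_norm 2 \<mu> (\<lambda>x. f x - (\<integral>z. f z \<partial>\<mu>)) powr (2 + 4 / \<epsilon>)
          \<le> inverse A * E f f * Lp_norm 1 \<mu> f powr (4 / \<epsilon>))"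

lemma stable_const_pos:
  assumes "0 < \<alpha>" "\<alpha> < 2"
  shows "0 < stable_const \<alpha>"
  using assms unfolding stable_const_def
  by (intro divide_pos_pos mult_pos_pos Gamma_real_pos) auto

lemma stable_energy_eq_dirichlet_form:
  assumes \<alpha>: "0 < \<alpha>" "\<alpha> < 2" and f: "f \<in> dirichlet_domain \<alpha> (speed_measure a)"
  shows "stable_energy \<alpha> f = ennreal (dirichlet_form \<alpha> f f)"
proof -
  let ?K = "stable_integrand \<alpha> f f"
  let ?I = "\<lambda>x. \<integral>\<^sup>+y. ennreal (?K x y) \<partial>lborel"
  have fm [measurable]: "f \<in> borel_measurable borel"
    using f by (auto simp: dirichlet_domain_def speed_measure_def cong: measurable_cong_sets)
  have K0: "0 \<le> ?K x y" for x y
    using stable_const_pos[OF \<alpha>] by (auto simp: stable_integrand_def)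
  have Km [measurable]: "(\<lambda>(x, y). ?K x y) \<in> borel_measurable (lborel \<Otimes>\<^sub>M lborel)"
    unfolding stable_integrand_def by measurable
  have fin: "(\<integral>\<^sup>+x. ?I x \<partial>lborel) < \<infinity>"
    using f by (auto simp: dirichlet_domain_def stable_energy_def ennreal_mult_less_top
        ennreal_divide_eq_top_iff less_top[symmetric] ennreal_mult_eq_top_iff)
  have Im [measurable]: "?I \<in> borel_measurable lborel"
    by measurable
  have inner: "(\<integral>y. ?K x y \<partial>lborel) = enn2real (?I x)" for x
    by (rule integral_eq_nn_integral)
      (use K0 in \<open>auto intro: measurable_compose_Pair1[OF _ Km, simplified]\<close>)
  have "AE x in lborel. ?I x \<noteq> \<infinity>"
    using fin by (intro nn_integral_PInf_AE) auto
  then have "(\<integral>\<^sup>+x. ennreal (\<integral>y. ?K x y \<partial>lborel) \<partial>lborel) = (\<integral>\<^sup>+x. ?I x \<partial>lborel)"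
    by (intro nn_integral_cong_AE) (auto simp: inner less_top)
  moreover have "(\<integral>x. (\<integral>y. ?K x y \<partial>lborel) \<partial>lborel)
      = enn2real (\<integral>\<^sup>+x. ennreal (\<integral>y. ?K x y \<partial>lborel) \<partial>lborel)"
    by (rule integral_eq_nn_integral) (auto simp: inner)
  ultimately have form: "dirichlet_form \<alpha> f f = 1 / 2 * enn2real (\<integral>\<^sup>+x. ?I x \<partial>lborel)"
    by (simp add: dirichlet_form_def)
  have half: "(1 / 2 :: ennreal) = ennreal (1 / 2)"
    using divide_ennreal[of 1 2] by simp
  have "ennreal (enn2real (\<integral>\<^sup>+x. ?I x \<partial>lborel)) = (\<integral>\<^sup>+x. ?I x \<partial>lborel)"
    using fin by (simp add: less_top)
  then show ?thesis
    unfolding form stable_energy_def half by (subst ennreal_mult) simp_all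
qed

end

theory Submission
  imports Defs
begin

text \<open>
  Since \<open>\<alpha> > 1\<close>, finite energy forces Hoelder continuity: outside a null set,
  \<open>(f x - f y)\<^sup>2 \<le> c \<cdot> E(f,f) \<cdot> \<bar>x - y\<bar>\<^bsup>\<alpha>-1\<^esup>\<close>. Hence, for a suitable point \<open>z\<close> of \<open>[-1,1]\<close>, the function
  \<open>h = f - f z\<close> is dominated by a multiple of \<open>(E(f,f) (1 + \<bar>x\<bar>)\<^bsup>\<alpha>-1\<^esup>)\<^bsup>1/2\<^esup>\<close>, and the tail condition
  says exactly that the latter function lies in weak \<open>L\<^bsup>p\<^esup>\<close> with the Sobolev exponent
  \<open>p = 2\<epsilon>/(\<epsilon>-2)\<close>. Interpolating \<open>L\<^bsup>2\<^esup>\<close> between \<open>L\<^bsup>1\<^esup>\<close> and weak \<open>L\<^bsup>p\<^esup>\<close> is the Nash inequality.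

  Conversely, a cutoff vanishing on \<open>[-r/2,r/2]\<close> and equal to 1 off \<open>(-r,r)\<close> has energy of order
  \<open>r\<^bsup>1-\<alpha>\<^esup>\<close>. The Nash inequality for it bounds the tail of \<open>\<mu>\<close> at \<open>r\<close> by a power of the tail at \<open>r/2\<close>,
  and this recursion, iterated over dyadic scales, yields the tail condition.
\<close>

section \<open>Choosing points by averaging\<close>

text \<open>Averaging argument: if every point of the interval violated one of the three bounds, the
  sum of the functions divided by \<open>U\<close>, \<open>V\<close>, \<open>W\<close> would have
  integral at least 4 there, while its total integral is at most 3. It yields points good in several
  respects at once.\<close>

lemma exists_simultaneous_density_bound:
  fixes u v w :: "real \<Rightarrow> ennreal"
  assumes [measurable]: "u \<in> borel_measurable borel" "v \<in> borel_measurable borel" "w \<in> borel_measurable borel"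
    and u: "(\<integral>\<^sup>+x. u x \<partial>lborel) \<le> ennreal U" and v: "(\<integral>\<^sup>+x. v x \<partial>lborel) \<le> ennreal V"
    and w: "(\<integral>\<^sup>+x. w x \<partial>lborel) \<le> ennreal W"
    and pos: "0 < U" "0 < V" "0 < W" "s < t"
  obtains x where "x \<in> {s..t}" "u x \<le> ennreal (4 * U / (t - s))" "v x \<le> ennreal (4 * V / (t - s))"
    "w x \<le> ennreal (4 * W / (t - s))"
proof -
  have "\<exists>x\<in>{s..t}. u x \<le> ennreal (4 * U / (t - s)) \<and> v x \<le> ennreal (4 * V / (t - s)) \<and>
    w x \<le> ennreal (4 * W / (t - s))"
  proof (rule ccontr)
    assume contr: "\<not> ?thesis"
    let ?g = "\<lambda>x. ennreal (1 / U) * u x + ennreal (1 / V) * v x + ennreal (1 / W) * w x"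
    have scale: "ennreal (4 / (t - s)) \<le> ennreal (1 / A) * b"
      if "0 < A" "\<not> b \<le> ennreal (4 * A / (t - s))" for A b
    proof -
      have "ennreal (4 / (t - s)) = ennreal (1 / A) * ennreal (4 * A / (t - s))"
        using that pos by (subst ennreal_mult[symmetric]) auto
      also have "\<dots> \<le> ennreal (1 / A) * b"
        using that by (intro mult_left_mono) auto
      finally show ?thesis .
    qed
    \<comment> \<open>The one normalised summand whose bound fails at \<open>x\<close> already
      exceeds the threshold.\<close>
    have le: "ennreal (4 / (t - s)) * indicator {s..t} x \<le> ?g x" for x
    proof (cases "x \<in> {s..t}")
      case True
      then consider "\<not> u x \<le> ennreal (4 * U / (t - s))" | "\<not> v x \<le> ennreal (4 * V / (t - s))" |
        "\<not> w x \<le> ennreal (4 * W / (t - s))" using contr by blast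
      then have "ennreal (4 / (t - s)) \<le> ?g x"
        by cases (use scale pos in \<open>force intro: add_increasing add_increasing2\<close>)+
      then show ?thesis using True by simp
    qed auto
    have one: "ennreal (1 / A) * b \<le> 1" if "0 < A" "b \<le> ennreal A" for A b
    proof -
      have "ennreal (1 / A) * b \<le> ennreal (1 / A) * ennreal A"
        using that by (intro mult_left_mono) auto
      also have "\<dots> = 1" using that by (subst ennreal_mult[symmetric]) auto
      finally show ?thesis .
    qed
    have "4 = (\<integral>\<^sup>+x. ennreal (4 / (t - s)) * indicator {s..t} x \<partial>lborel)"
    proof -
      have "ennreal (4 / (t - s)) * ennreal (t - s) = ennreal (4 / (t - s) * (t - s))"
        using pos by (subst ennreal_mult[symmetric]) auto
      also have "4 / (t - s) * (t - s) = 4" using pos by (simp only: times_divide_eq_left) (intro nonzero_mult_div_cancel_right, simp)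
      finally have "ennreal (4 / (t - s)) * ennreal (t - s) = 4" by simp
      then show ?thesis using pos by (simp add: nn_integral_cmult_indicator)
    qed
    also have "\<dots> \<le> (\<integral>\<^sup>+x. ?g x \<partial>lborel)"
      by (intro nn_integral_mono le)
    also have "\<dots> = ennreal (1 / U) * (\<integral>\<^sup>+x. u x \<partial>lborel) + ennreal (1 / V) * (\<integral>\<^sup>+x. v x \<partial>lborel)
       + ennreal (1 / W) * (\<integral>\<^sup>+x. w x \<partial>lborel)"
      by (simp add: nn_integral_add nn_integral_cmult)
    also have "\<dots> \<le> 1 + 1 + 1"
      using one u v w pos by (intro add_mono) auto
    finally show False by simp
  qed
  then show thesis using that by blast
qed

lemma sqrt_powr: "sqrt (r powr b) = r powr (b / 2)"
  by (cases "r = 0") (simp_all add: powr_half_sqrt[symmetric] powr_powr)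

section \<open>Hoelder continuity of functions of finite energy\<close>

text \<open>The density of the energy in the first variable. The factor one half is left out, so the
  total integral is twice the form.\<close>

definition stable_potential :: "real \<Rightarrow> (real \<Rightarrow> real) \<Rightarrow> real \<Rightarrow> ennreal" where
  "stable_potential \<alpha> f x = (\<integral>\<^sup>+y. ennreal (stable_integrand \<alpha> f f x y) \<partial>lborel)"

text \<open>The square of \<open>2 * holder_factor / (1 - ratio)\<close> without its factor
  \<open>T\<close>: two geometric chains, one to each end point, with one-step constant
  \<open>2 powr (5 + \<alpha>) / stable_const \<alpha>\<close>.\<close>

definition holder_const :: "real \<Rightarrow> real" where
  "holder_const \<alpha> = 4 * 2 powr (5 + \<alpha>) / (stable_const \<alpha> * (1 - 2 powr (- (\<alpha> - 1) / 2))\<^sup>2)"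

text \<open>\<open>T\<close> is strictly positive so that it can normalise a density in the
  averaging argument; zero energy is recovered afterwards by a limit.\<close>

locale finite_energy =
  fixes \<alpha> :: real and f :: "real \<Rightarrow> real" and T :: real
  assumes alpha: "1 < \<alpha>" "\<alpha> < 2"
    and f_measurable [measurable]: "f \<in> borel_measurable borel"
    and T_pos: "0 < T"
    and energy_le: "(\<integral>\<^sup>+x. stable_potential \<alpha> f x \<partial>lborel) \<le> ennreal T"
begin

abbreviation potential :: "real \<Rightarrow> ennreal" where
  "potential \<equiv> stable_potential \<alpha> f"

lemma const_pos: "0 < stable_const \<alpha>"
  using alpha by (intro stable_const_pos) auto

lemma integrand_measurable [measurable]:
  "(\<lambda>(x, y). stable_integrand \<alpha> f f x y) \<in> borel_measurable (borel \<Otimes>\<^sub>M borel)"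
  unfolding stable_integrand_def by measurable

lemma potential_measurable [measurable]: "potential \<in> borel_measurable borel"
  unfolding stable_potential_def by measurable

lemma increment_le:
  assumes "ennreal (stable_integrand \<alpha> f f x y) \<le> ennreal b" "\<bar>x - y\<bar> \<le> d" "0 \<le> b"
  shows "(f x - f y)\<^sup>2 \<le> d powr (1 + \<alpha>) * b / stable_const \<alpha>"
proof (cases "x = y")
  case True
  then show ?thesis using assms const_pos by simp
next
  case False
  let ?k = "\<bar>x - y\<bar> powr (1 + \<alpha>)"
  have k: "0 < ?k" using False by simp
  have "(f x - f y)\<^sup>2 * stable_const \<alpha> = stable_integrand \<alpha> f f x y * ?k"
    using k by (simp add: stable_integrand_def power2_eq_square)
  also have "\<dots> \<le> b * ?k"
    using assms by (intro mult_right_mono) (auto simp: ennreal_le_iff)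
  also have "\<dots> \<le> b * d powr (1 + \<alpha>)"
    using assms alpha by (intro mult_left_mono powr_mono2) auto
  finally show ?thesis using const_pos by (simp add: field_simps)
qed

text \<open>
  As in the Garsia--Rodemich--Rumsey argument, a chain of points of controlled potential at dyadic
  scales replaces averages and Lebesgue points: finiteness of the potential at the target \<open>x\<close> alone
  makes \<open>f\<close> converge to \<open>f x\<close> along the chain.
\<close>

lemma chain_step:
  assumes x: "potential x \<le> ennreal e" "0 < e" and z: "potential z \<le> ennreal (4 * T / r)" "\<bar>z - x\<bar> \<le> r"
    and r: "0 < r"
  obtains w where "\<bar>w - x\<bar> \<le> r / 2" "potential w \<le> ennreal (4 * T / (r / 2))"
    "(f z - f w)\<^sup>2 \<le> 2 powr (5 + \<alpha>) / stable_const \<alpha> * T * r powr (\<alpha> - 1)"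
    "(f x - f w)\<^sup>2 \<le> 4 * e / stable_const \<alpha> * r powr \<alpha>"
proof -
  \<comment> \<open>Three demands on an interval of length \<open>r\<close>: a small increment from
    \<open>z\<close>, with total \<open>4 * T / r\<close> given by its potential; small potential at
    \<open>w\<close> itself, so that the chain can continue; and a small increment from the target
    \<open>x\<close>.\<close>
  obtain w where w: "w \<in> {x - r/2 .. x + r/2}"
    "ennreal (stable_integrand \<alpha> f f z w) \<le> ennreal (4 * (4 * T / r) / ((x + r/2) - (x - r/2)))"
    "potential w \<le> ennreal (4 * T / ((x + r/2) - (x - r/2)))"
    "ennreal (stable_integrand \<alpha> f f x w) \<le> ennreal (4 * e / ((x + r/2) - (x - r/2)))"
    by (rule exists_simultaneous_density_bound[of "\<lambda>w. ennreal (stable_integrand \<alpha> f f z w)" potential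
          "\<lambda>w. ennreal (stable_integrand \<alpha> f f x w)" "4 * T / r" T e "x - r/2" "x + r/2"])
      (use assms T_pos energy_le in \<open>auto simp: stable_potential_def[symmetric]\<close>)
  have near: "\<bar>w - x\<bar> \<le> r / 2" using w(1) unfolding atLeastAtMost_iff by linarith
  \<comment> \<open>The averaging bound for the integrand is \<open>4 * (4 * T / r) / r\<close>, and
    \<open>2 * r\<close> is a convenient bound for the distance \<open>3 * r / 2\<close>.\<close>
  have "(f z - f w)\<^sup>2 \<le> (2 * r) powr (1 + \<alpha>) * (16 * T / r\<^sup>2) / stable_const \<alpha>"
  proof (rule increment_le)
    show "\<bar>z - w\<bar> \<le> 2 * r" using near z(2) r by linarith
  qed (use w(2) r T_pos in \<open>simp_all add: power2_eq_square\<close>)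
  also have "(2 * r) powr (1 + \<alpha>) * (16 * T / r\<^sup>2) = 2 powr (5 + \<alpha>) * T * r powr (\<alpha> - 1)"
  proof -
    have "2 powr (5 + \<alpha>) = 2 powr (1 + \<alpha>) * (16::real)"
      using powr_add[of "2::real" "1 + \<alpha>" 4] by (simp add: add.commute)
    moreover have "r powr (\<alpha> - 1) = r powr (1 + \<alpha>) / r\<^sup>2"
      using r powr_diff[of r "1 + \<alpha>" 2] by simp
    ultimately show ?thesis using r by (simp add: powr_mult)
  qed
  finally have 1: "(f z - f w)\<^sup>2 \<le> 2 powr (5 + \<alpha>) / stable_const \<alpha> * T * r powr (\<alpha> - 1)"
    by simp
  have "(f x - f w)\<^sup>2 \<le> r powr (1 + \<alpha>) * (4 * e / r) / stable_const \<alpha>"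
  proof (rule increment_le)
    show "\<bar>x - w\<bar> \<le> r" using near r by linarith
  qed (use w(4) r x in simp_all)
  also have "r powr (1 + \<alpha>) * (4 * e / r) / stable_const \<alpha> = 4 * e / stable_const \<alpha> * r powr \<alpha>"
    using r by (simp add: powr_add)
  finally have 2: "(f x - f w)\<^sup>2 \<le> 4 * e / stable_const \<alpha> * r powr \<alpha>" .
  have "potential w \<le> ennreal (4 * T / r)" using w(3) by simp
  also have "\<dots> \<le> ennreal (4 * T / (r / 2))"
    using T_pos r by (intro ennreal_leI) (simp add: field_simps)
  finally show thesis using that near 1 2 by simp
qed

definition holder_factor :: real where
  "holder_factor = sqrt (2 powr (5 + \<alpha>) / stable_const \<alpha> * T)"

abbreviation ratio :: real where "ratio \<equiv> 2 powr (- (\<alpha> - 1) / 2)"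

lemma ratio: "0 < ratio" "ratio < 1"
  using alpha by (auto intro: powr_less_one)

lemma holder_factor_nonneg: "0 \<le> holder_factor"
  unfolding holder_factor_def using T_pos const_pos by auto

text \<open>Iterating the step at the scales \<open>r / 2 ^ k\<close>, the increments form a
  geometric series with quotient \<open>ratio\<close>. The last clause comes from the step that
  produced \<open>w\<close>, made at the previous scale, hence the index \<open>n - 1\<close> and
  the exclusion of \<open>n = 0\<close>.\<close>

lemma chain:
  assumes x: "potential x \<le> ennreal e" "0 < e" and z: "potential z \<le> ennreal (4 * T / r)" "\<bar>z - x\<bar> \<le> r"
    and r: "0 < r"
  shows "\<exists>w. \<bar>w - x\<bar> \<le> r / 2 ^ n \<and> potential w \<le> ennreal (4 * T / (r / 2 ^ n)) \<and>
    \<bar>f z - f w\<bar> \<le> holder_factor * r powr ((\<alpha> - 1) / 2) * (\<Sum>k<n. ratio ^ k) \<and>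
    (0 < n \<longrightarrow> (f x - f w)\<^sup>2 \<le> 4 * e / stable_const \<alpha> * (r / 2 ^ (n - 1)) powr \<alpha>)"
proof (induction n)
  case 0
  then show ?case using z by (intro exI[of _ z]) auto
next
  case (Suc n)
  then obtain w where w: "\<bar>w - x\<bar> \<le> r / 2 ^ n" "potential w \<le> ennreal (4 * T / (r / 2 ^ n))"
    "\<bar>f z - f w\<bar> \<le> holder_factor * r powr ((\<alpha> - 1) / 2) * (\<Sum>k<n. ratio ^ k)" by blast
  obtain w' where w': "\<bar>w' - x\<bar> \<le> (r / 2 ^ n) / 2" "potential w' \<le> ennreal (4 * T / ((r / 2 ^ n) / 2))"
    "(f w - f w')\<^sup>2 \<le> 2 powr (5 + \<alpha>) / stable_const \<alpha> * T * (r / 2 ^ n) powr (\<alpha> - 1)"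
    "(f x - f w')\<^sup>2 \<le> 4 * e / stable_const \<alpha> * (r / 2 ^ n) powr \<alpha>"
    by (rule chain_step[OF x w(2,1)]) (use r in auto)
  have "\<bar>f w - f w'\<bar> \<le> holder_factor * sqrt ((r / 2 ^ n) powr (\<alpha> - 1))"
    using real_sqrt_le_mono[OF w'(3)] unfolding real_sqrt_mult holder_factor_def by simp
  also have "sqrt ((r / 2 ^ n) powr (\<alpha> - 1)) = r powr ((\<alpha> - 1) / 2) * ratio ^ n"
  proof -
    have "(1 / 2 ^ n) powr ((\<alpha> - 1) / 2) = ratio ^ n"
    proof -
      have "1 / 2 ^ n = (2::real) powr (- real n)"
        by (simp add: powr_minus_divide powr_realpow)
      moreover have "ratio ^ n = ratio powr real n"
        by (simp add: powr_realpow)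
      moreover have "- real n * ((\<alpha> - 1) / 2) = - (\<alpha> - 1) / 2 * real n" by (simp add: field_simps)
      ultimately show ?thesis by (simp only: powr_powr)
    qed
    moreover have "(r / 2 ^ n) powr ((\<alpha> - 1) / 2) = r powr ((\<alpha> - 1) / 2) * (1 / 2 ^ n) powr ((\<alpha> - 1) / 2)"
      using r by (subst powr_mult[symmetric]) auto
    ultimately show ?thesis by (simp add: sqrt_powr)
  qed
  finally have "\<bar>f z - f w'\<bar> \<le> holder_factor * r powr ((\<alpha> - 1) / 2) * (\<Sum>k<Suc n. ratio ^ k)"
    using w(3) by (simp add: algebra_simps)
  then show ?case using w' by (intro exI[of _ w']) (auto simp: field_simps)
qed

text \<open>The chain from \<open>z\<close> approaches \<open>x\<close>. The size of the potential
  at \<open>x\<close> affects only the final gap, which tends to 0 with the scale, so it does not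
  enter the constant.\<close>

lemma potential_finite_increment:
  assumes x: "potential x < \<infinity>" and z: "potential z \<le> ennreal (4 * T / r)" "\<bar>z - x\<bar> \<le> r"
    and r: "0 < r"
  shows "\<bar>f z - f x\<bar> \<le> holder_factor / (1 - ratio) * r powr ((\<alpha> - 1) / 2)"
proof -
  \<comment> \<open>The added 1 makes \<open>e\<close> positive even where the potential
    vanishes.\<close>
  define e where "e = enn2real (potential x) + 1"
  have e: "potential x \<le> ennreal e" "0 < e"
    using x by (auto simp: e_def less_top ennreal_plus add_nonneg_pos intro: order_trans[OF _ add_increasing2])
  have bd: "\<bar>f z - f x\<bar> \<le> holder_factor / (1 - ratio) * r powr ((\<alpha> - 1) / 2)
      + sqrt (4 * e / stable_const \<alpha> * (r * (1 / 2) ^ n) powr \<alpha>)" for n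
  proof -
    obtain w where w: "\<bar>f z - f w\<bar> \<le> holder_factor * r powr ((\<alpha> - 1) / 2) * (\<Sum>k<Suc n. ratio ^ k)"
      "(f x - f w)\<^sup>2 \<le> 4 * e / stable_const \<alpha> * (r / 2 ^ n) powr \<alpha>"
      using chain[OF e z r, of "Suc n"] by auto
    have "(\<Sum>k<Suc n. ratio ^ k) \<le> 1 / (1 - ratio)"
      using ratio by (subst sum_gp_strict) (auto simp: divide_simps)
    then have "holder_factor * r powr ((\<alpha> - 1) / 2) * (\<Sum>k<Suc n. ratio ^ k)
        \<le> holder_factor * r powr ((\<alpha> - 1) / 2) * (1 / (1 - ratio))"
      using holder_factor_nonneg by (intro mult_left_mono) auto
    moreover have "\<bar>f x - f w\<bar> \<le> sqrt (4 * e / stable_const \<alpha> * (r / 2 ^ n) powr \<alpha>)"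
      using real_sqrt_le_mono[OF w(2)] by simp
    ultimately show ?thesis using w(1) by (simp add: power_divide)
  qed
  have "(\<lambda>n. (r * (1 / 2) ^ n)) \<longlonglongrightarrow> r * 0"
    by (intro tendsto_intros) auto
  then have "(\<lambda>n. (r * (1 / 2) ^ n) powr \<alpha>) \<longlonglongrightarrow> 0 powr \<alpha>"
    using alpha r by (intro tendsto_powr') auto
  then have "(\<lambda>n. holder_factor / (1 - ratio) * r powr ((\<alpha> - 1) / 2)
      + sqrt (4 * e / stable_const \<alpha> * (r * (1 / 2) ^ n) powr \<alpha>))
      \<longlonglongrightarrow> holder_factor / (1 - ratio) * r powr ((\<alpha> - 1) / 2) + sqrt (4 * e / stable_const \<alpha> * 0 powr \<alpha>)"
    by (intro tendsto_add tendsto_mult tendsto_real_sqrt tendsto_const)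
  then have "(\<lambda>n. holder_factor / (1 - ratio) * r powr ((\<alpha> - 1) / 2)
      + sqrt (4 * e / stable_const \<alpha> * (r * (1 / 2) ^ n) powr \<alpha>))
      \<longlonglongrightarrow> holder_factor / (1 - ratio) * r powr ((\<alpha> - 1) / 2)"
    by simp
  then show ?thesis
    by (rule LIMSEQ_le_const) (use bd in blast)
qed

text \<open>The potentials at \<open>x\<close> and \<open>y\<close> are finite but uncontrolled, so
  both points are compared with an intermediate \<open>z\<close> whose potential is at most
  \<open>4 * T / r\<close>.\<close>

lemma holder_bound:
  assumes x: "potential x < \<infinity>" and y: "potential y < \<infinity>"
  shows "(f x - f y)\<^sup>2 \<le> holder_const \<alpha> * T * \<bar>x - y\<bar> powr (\<alpha> - 1)"
proof (cases "x = y")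
  case False
  define r where "r = \<bar>x - y\<bar>"
  have r: "0 < r" using False by (simp add: r_def)
  obtain z where z: "z \<in> {min x y .. max x y}" "potential z \<le> ennreal (4 * T / r)"
  proof -
    have "max x y - min x y = r" by (auto simp: r_def)
    then show ?thesis
      \<comment> \<open>Only one function has to be controlled here, so it is entered three
        times.\<close>
      using exists_simultaneous_density_bound[of potential potential potential T T T "min x y" "max x y"]
        that T_pos r energy_le by (auto simp: stable_potential_def[symmetric] split: if_splits)
  qed
  then have "\<bar>z - x\<bar> \<le> r" "\<bar>z - y\<bar> \<le> r" by (auto simp: r_def)
  then have "\<bar>f z - f x\<bar> \<le> holder_factor / (1 - ratio) * r powr ((\<alpha> - 1) / 2)"
    "\<bar>f z - f y\<bar> \<le> holder_factor / (1 - ratio) * r powr ((\<alpha> - 1) / 2)"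
    using potential_finite_increment x y z(2) r by auto
  then have "\<bar>f x - f y\<bar> \<le> 2 * (holder_factor / (1 - ratio) * r powr ((\<alpha> - 1) / 2))" by linarith
  then have "\<bar>f x - f y\<bar>\<^sup>2 \<le> (2 * (holder_factor / (1 - ratio) * r powr ((\<alpha> - 1) / 2)))\<^sup>2"
    by (intro power_mono) auto
  also have "\<dots> = holder_const \<alpha> * T * r powr (\<alpha> - 1)"
  proof -
    have "(r powr ((\<alpha> - 1) / 2))\<^sup>2 = r powr (\<alpha> - 1)"
      using r by (simp add: power2_eq_square powr_add[symmetric])
    moreover have "holder_factor\<^sup>2 = 2 powr (5 + \<alpha>) / stable_const \<alpha> * T"
      unfolding holder_factor_def using T_pos const_pos by auto
    ultimately show ?thesis by (simp add: holder_const_def power_mult_distrib power_divide)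
  qed
  finally show ?thesis by (simp add: r_def)
qed simp

end

text \<open>The bound holds for every \<open>S > T\<close>; letting \<open>S\<close> decrease to
  \<open>T\<close> admits \<open>T = 0\<close>, hence the energy itself as \<open>T\<close>.\<close>

lemma increment_le_holder:
  assumes \<alpha>: "1 < \<alpha>" "\<alpha> < 2" and f: "f \<in> borel_measurable borel" and T: "0 \<le> T"
    and energy: "(\<integral>\<^sup>+x. stable_potential \<alpha> f x \<partial>lborel) \<le> ennreal T"
    and fin: "stable_potential \<alpha> f x < \<infinity>" "stable_potential \<alpha> f y < \<infinity>"
  shows "(f x - f y)\<^sup>2 \<le> holder_const \<alpha> * T * \<bar>x - y\<bar> powr (\<alpha> - 1)"
proof -
  have bd: "(f x - f y)\<^sup>2 \<le> holder_const \<alpha> * S * \<bar>x - y\<bar> powr (\<alpha> - 1)" if "T < S" for S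
  proof -
    interpret finite_energy \<alpha> f S
      using assms that by unfold_locales (auto intro: order_trans[OF _ ennreal_leI])
    show ?thesis by (rule holder_bound[OF fin])
  qed
  have "((\<lambda>S. holder_const \<alpha> * S * \<bar>x - y\<bar> powr (\<alpha> - 1))
     \<longlongrightarrow> holder_const \<alpha> * T * \<bar>x - y\<bar> powr (\<alpha> - 1)) (at_right T)"
    by (intro tendsto_intros)
  then show ?thesis
    by (rule tendsto_lowerbound)
       (use bd in \<open>auto simp: eventually_at_right_field intro!: exI[of _ "T + 1"]\<close>)
qed

lemma holder_const_pos: "1 < \<alpha> \<Longrightarrow> \<alpha> < 2 \<Longrightarrow> 0 < holder_const \<alpha>"
  using stable_const_pos[of \<alpha>] powr_less_one[of 2 "- (\<alpha> - 1) / 2"]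
  unfolding holder_const_def by (intro divide_pos_pos mult_pos_pos zero_less_power) auto

section \<open>Interpolation between weak Lebesgue spaces\<close>

lemma nn_integral_powr_atLeast:
  fixes t q :: real
  assumes "0 < t" "1 < q"
  shows "(\<integral>\<^sup>+s. ennreal (s powr (- q)) * indicator {t..} s \<partial>lborel) = ennreal (t powr (1 - q) / (q - 1))"
proof -
  have "((\<lambda>s. s powr (- q)) has_integral - (t powr (- q + 1)) / (- q + 1)) {t..}"
    using has_integral_powr_to_inf[of "- q" t] assms by simp
  then have "(\<integral>\<^sup>+s. ennreal (s powr (- q)) * indicator {t..} s \<partial>lborel) = ennreal (- (t powr (- q + 1)) / (- q + 1))"
    by (intro nn_integral_has_integral_lebesgue') auto
  also have "- (t powr (- q + 1)) / (- q + 1) = t powr (1 - q) / (q - 1)"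
    using assms by (simp add: divide_simps) (simp add: algebra_simps)
  finally show ?thesis .
qed

lemma nn_integral_powr_atMost:
  fixes t q :: real
  assumes "0 < t" "- 1 < q"
  shows "(\<integral>\<^sup>+s. ennreal (s powr q) * indicator {0..t} s \<partial>lborel) = ennreal (t powr (q + 1) / (q + 1))"
  using assms by (intro nn_integral_has_integral_lebesgue' has_integral_powr_from_0) auto

text \<open>The square of \<open>h x\<close> is the integral of \<open>2 * s\<close> over
  \<open>0 \<le> s < \<bar>h x\<bar>\<close>; Tonelli exchanges the integrals.\<close>

lemma nn_integral_square_layer_cake:
  fixes h :: "'a \<Rightarrow> real"
  assumes "sigma_finite_measure M" and [measurable]: "h \<in> borel_measurable M"
  shows "(\<integral>\<^sup>+x. ennreal ((h x)\<^sup>2) \<partial>M)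
     = (\<integral>\<^sup>+s. ennreal (2 * s) * indicator {0..} s * emeasure M {x \<in> space M. s < \<bar>h x\<bar>} \<partial>lborel)"
proof -
  interpret sigma_finite_measure M by fact
  interpret pair_sigma_finite M lborel ..
  have sq: "ennreal ((h x)\<^sup>2) = (\<integral>\<^sup>+s. ennreal (2 * s) * indicator {0..} s * indicator {..<\<bar>h x\<bar>} s \<partial>lborel)" for x
  proof -
    have "(\<integral>\<^sup>+s. ennreal (2 * s) * indicator {0..\<bar>h x\<bar>} s \<partial>lborel) = ennreal (\<bar>h x\<bar>\<^sup>2 - 0\<^sup>2)"
      by (rule nn_integral_FTC_Icc) (auto intro!: derivative_eq_intros)
    \<comment> \<open>The half-open and the closed interval differ only in the end point, a null
      set.\<close>
    moreover have "AE s in lborel. ennreal (2 * s) * indicator {0..} s * indicator {..<\<bar>h x\<bar>} s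
       = ennreal (2 * s) * indicator {0..\<bar>h x\<bar>} s"
      using AE_lborel_singleton[of "\<bar>h x\<bar>"] by eventually_elim (auto split: split_indicator)
    ultimately show ?thesis by (simp cong: nn_integral_cong_AE)
  qed
  have "(\<integral>\<^sup>+x. ennreal ((h x)\<^sup>2) \<partial>M)
     = (\<integral>\<^sup>+x. (\<integral>\<^sup>+s. ennreal (2 * s) * indicator {0..} s * indicator {s. s < \<bar>h x\<bar>} s \<partial>lborel) \<partial>M)"
    by (simp add: sq lessThan_def)
  also have "\<dots> = (\<integral>\<^sup>+s. (\<integral>\<^sup>+x. ennreal (2 * s) * indicator {0..} s * indicator {s. s < \<bar>h x\<bar>} s \<partial>M) \<partial>lborel)"
    unfolding indicator_def by (rule Fubini'[symmetric]) simp
  also have "\<dots> = (\<integral>\<^sup>+s. ennreal (2 * s) * indicator {0..} s * emeasure M {x \<in> space M. s < \<bar>h x\<bar>} \<partial>lborel)"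
  proof (rule nn_integral_cong)
    fix s :: real
    have "(\<integral>\<^sup>+x. ennreal (2 * s) * indicator {0..} s * indicator {s. s < \<bar>h x\<bar>} s \<partial>M)
       = (\<integral>\<^sup>+x. ennreal (2 * s) * indicator {0..} s * indicator {x \<in> space M. s < \<bar>h x\<bar>} x \<partial>M)"
      by (intro nn_integral_cong) (auto split: split_indicator)
    then show "(\<integral>\<^sup>+x. ennreal (2 * s) * indicator {0..} s * indicator {s. s < \<bar>h x\<bar>} s \<partial>M)
      = ennreal (2 * s) * indicator {0..} s * emeasure M {x \<in> space M. s < \<bar>h x\<bar>}"
      by (simp add: nn_integral_cmult)
  qed
  finally show ?thesis .
qed

lemma emeasure_Markov_abs:
  assumes h: "integrable M h" and s: "0 < s"
  shows "emeasure M {x \<in> space M. s < \<bar>h x\<bar>} \<le> ennreal ((\<integral>x. \<bar>h x\<bar> \<partial>M) / s)"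
proof -
  have [measurable]: "h \<in> borel_measurable M" using h by auto
  have "emeasure M {x \<in> space M. s < \<bar>h x\<bar>} \<le> emeasure M {x \<in> space M. s \<le> \<bar>h x\<bar>}"
    by (intro emeasure_mono) auto
  also have "\<dots> \<le> ennreal (1 / s) * (\<integral>\<^sup>+x. ennreal \<bar>h x\<bar> \<partial>M)"
  proof -
    have "s \<le> \<bar>h x\<bar> \<longleftrightarrow> 1 \<le> ennreal (1 / s) * ennreal \<bar>h x\<bar>" for x
      using s by (simp add: ennreal_mult[symmetric] ennreal_1[symmetric] del: ennreal_1)
    then show ?thesis
      using nn_integral_Markov_inequality[of "\<lambda>x. ennreal \<bar>h x\<bar>" "space M" M "ennreal (1 / s)"]
      by (simp add: nn_integral_restrict_space[symmetric] cong: nn_integral_cong)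
  qed
  also have "\<dots> = ennreal ((\<integral>x. \<bar>h x\<bar> \<partial>M) / s)"
    using s h by (subst nn_integral_eq_integral) (auto simp: ennreal_mult[symmetric])
  finally show ?thesis .
qed

text \<open>The layer cake integral is cut at height \<open>t\<close>: below it Markov's inequality
  bounds the integrand by a constant, above it the weak bound leaves the power \<open>1 - p\<close>,
  integrable at infinity because \<open>p > 2\<close>.\<close>

lemma weak_Lp_second_moment_split:
  fixes h :: "'a \<Rightarrow> real"
  assumes "sigma_finite_measure M" and h: "integrable M h" and p: "2 < p" and K: "0 \<le> K"
    and tail: "\<And>s. 0 < s \<Longrightarrow> emeasure M {x \<in> space M. s < \<bar>h x\<bar>} \<le> ennreal (K * s powr (- p))"
    and t: "0 < t"
  shows "(\<integral>\<^sup>+x. ennreal ((h x)\<^sup>2) \<partial>M)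
     \<le> ennreal (2 * t * (\<integral>x. \<bar>h x\<bar> \<partial>M) + 2 * K * t powr (2 - p) / (p - 2))"
proof -
  define N where "N = (\<integral>x. \<bar>h x\<bar> \<partial>M)"
  have N: "0 \<le> N" by (simp add: N_def)
  have [measurable]: "h \<in> borel_measurable M" using h by auto
  have le: "ennreal (2 * s) * indicator {0..} s * emeasure M {x \<in> space M. s < \<bar>h x\<bar>}
    \<le> ennreal (2 * N) * indicator {0..t} s + ennreal (2 * K) * (ennreal (s powr (- (p - 1))) * indicator {t..} s)" for s
  proof (cases "0 < s")
    case False
    then show ?thesis by (cases "s = 0") auto
  next
    case s: True
    show ?thesis
    proof (cases "s \<le> t")
      case True
      have "ennreal (2 * s) * emeasure M {x \<in> space M. s < \<bar>h x\<bar>} \<le> ennreal (2 * s) * ennreal (N / s)"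
        unfolding N_def by (intro mult_left_mono emeasure_Markov_abs h s) auto
      also have "\<dots> = ennreal (2 * N)" using s by (subst ennreal_mult[symmetric]) (auto simp: N)
      finally show ?thesis using s True by (auto intro: add_increasing2)
    next
      case False
      have "ennreal (2 * s) * emeasure M {x \<in> space M. s < \<bar>h x\<bar>} \<le> ennreal (2 * s) * ennreal (K * s powr (- p))"
        by (intro mult_left_mono tail s) auto
      also have "\<dots> = ennreal (2 * K * (s * s powr (- p)))"
        using s K by (subst ennreal_mult[symmetric]) (auto simp: ac_simps)
      also have "s * s powr (- p) = s powr (- (p - 1))"
        using s powr_add[of s 1 "- p"] by simp
      finally show ?thesis using s False K by (auto simp: ennreal_mult)
    qed
  qed
  have "(\<integral>\<^sup>+x. ennreal ((h x)\<^sup>2) \<partial>M) \<le> (\<integral>\<^sup>+s. ennreal (2 * N) * indicator {0..t} s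
      + ennreal (2 * K) * (ennreal (s powr (- (p - 1))) * indicator {t..} s) \<partial>lborel)"
    by (subst nn_integral_square_layer_cake[OF assms(1)]) (simp_all only: nn_integral_mono le assms(1) h borel_measurable_integrable)
  also have "\<dots> = ennreal (2 * N) * ennreal t + ennreal (2 * K) * ennreal (t powr (1 - (p - 1)) / ((p - 1) - 1))"
    using t p nn_integral_powr_atLeast[of t "p - 1"]
    by (subst nn_integral_add) (auto simp: nn_integral_cmult nn_integral_cmult_indicator)
  also have "\<dots> = ennreal (2 * t * N + 2 * K * t powr (2 - p) / (p - 2))"
    using t p N K by (simp add: ennreal_mult[symmetric] ennreal_plus[symmetric] ac_simps del: ennreal_plus)
  finally show ?thesis unfolding N_def .
qed

text \<open>Optimising the cut of the previous lemma makes both terms multiples of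
  \<open>t * N\<close>. The estimate stays in powers, without roots, so that the exponents match the
  Nash inequality after one further power.\<close>

lemma weak_Lp_L1_interpolation:
  fixes h :: "'a \<Rightarrow> real"
  assumes "sigma_finite_measure M" and h: "integrable M h" and p: "2 < p" and K: "0 \<le> K"
    and tail: "\<And>s. 0 < s \<Longrightarrow> emeasure M {x \<in> space M. s < \<bar>h x\<bar>} \<le> ennreal (K * s powr (- p))"
  shows "(\<integral>x. (h x)\<^sup>2 \<partial>M) powr (p - 1)
     \<le> (2 + 2 / (p - 2)) powr (p - 1) * (\<integral>x. \<bar>h x\<bar> \<partial>M) powr (p - 2) * K"
proof -
  define N where "N = (\<integral>x. \<bar>h x\<bar> \<partial>M)"
  have N: "0 \<le> N" by (simp add: N_def)
  have [measurable]: "h \<in> borel_measurable M" using h by auto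
  define S where "S = (\<integral>x. (h x)\<^sup>2 \<partial>M)"
  have S0: "0 \<le> S" by (simp add: S_def)
  have split: "S \<le> 2 * t * N + 2 * L * t powr (2 - p) / (p - 2)" if t: "0 < t" and L: "K \<le> L" for t L
  proof -
    have "(\<integral>\<^sup>+x. ennreal ((h x)\<^sup>2) \<partial>M) \<le> ennreal (2 * t * N + 2 * K * t powr (2 - p) / (p - 2))"
      unfolding N_def using assms t by (intro weak_Lp_second_moment_split) auto
    then have "S \<le> 2 * t * N + 2 * K * t powr (2 - p) / (p - 2)"
      unfolding S_def using p t N K by (intro integral_real_bounded) auto
    also have "\<dots> \<le> 2 * t * N + 2 * L * t powr (2 - p) / (p - 2)"
      using p L by (intro add_left_mono divide_right_mono mult_right_mono) auto
    finally show ?thesis .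
  qed
  \<comment> \<open>A positive \<open>L\<close> above \<open>K\<close> keeps the threshold positive;
    \<open>K\<close> itself, possibly 0, is reached by a limit. If \<open>N = 0\<close>, then
    \<open>h\<close> vanishes almost everywhere.\<close>
  have bd: "S powr (p - 1) \<le> (2 + 2 / (p - 2)) powr (p - 1) * N powr (p - 2) * L" if L: "K \<le> L" "0 < L" for L
  proof (cases "N = 0")
    case True
    then have "AE x in M. \<bar>h x\<bar> = 0"
      unfolding N_def using h integral_nonneg_eq_0_iff_AE[of M "\<lambda>x. \<bar>h x\<bar>"] by auto
    then have "S = (\<integral>x. 0 \<partial>M)" unfolding S_def by (intro integral_cong_AE) auto
    then show ?thesis using L by simp
  next
    case False
    then have Np: "0 < N" using N by simp
    \<comment> \<open>this threshold balances the two terms of the splitting\<close>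
    define t where "t = (L / N) powr (1 / (p - 1))"
    have t: "0 < t" using L Np by (simp add: t_def)
    have tp: "t powr (p - 1) = L / N" using L Np p by (simp add: t_def powr_powr)
    have "L * t powr (2 - p) = L * t / t powr (p - 1)"
      using t powr_diff[of t 1 "p - 1"] by (simp add: algebra_simps)
    also have "\<dots> = t * N" using Np L by (simp add: tp)
    finally have e: "L * t powr (2 - p) = t * N" .
    have "S \<le> 2 * t * N + 2 * (L * t powr (2 - p)) / (p - 2)" using split[OF t L(1)] by simp
    also have "\<dots> = (2 + 2 / (p - 2)) * (t * N)" unfolding e using p by (simp add: field_simps)
    finally have "S powr (p - 1) \<le> ((2 + 2 / (p - 2)) * (t * N)) powr (p - 1)"
      using S0 p by (intro powr_mono2) auto
    also have "\<dots> = (2 + 2 / (p - 2)) powr (p - 1) * (L / N * N powr (p - 1))"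
      using p t Np by (simp add: powr_mult tp)
    also have "L / N * N powr (p - 1) = N powr (p - 2) * L"
      using Np powr_diff[of N "p - 1" 1] by simp
    finally show ?thesis by (simp add: mult.assoc)
  qed
  have "((\<lambda>L. (2 + 2 / (p - 2)) powr (p - 1) * N powr (p - 2) * L)
    \<longlongrightarrow> (2 + 2 / (p - 2)) powr (p - 1) * N powr (p - 2) * K) (at_right K)"
    by (intro tendsto_intros)
  then have "S powr (p - 1) \<le> (2 + 2 / (p - 2)) powr (p - 1) * N powr (p - 2) * K"
    by (rule tendsto_lowerbound)
       (use bd K in \<open>auto simp: eventually_at_right_field intro!: exI[of _ "K + 1"]\<close>)
  then show ?thesis unfolding S_def N_def .
qed

section \<open>Sufficiency of the tail condition\<close>

text \<open>Expanding around the mean, the cross term integrates to 0. This allows centring at a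
  value \<open>f z\<close> instead of the mean.\<close>

lemma (in finite_measure) variance_le_second_moment:
  fixes f :: "'a \<Rightarrow> real"
  assumes total: "measure M (space M) = 1" and [measurable]: "f \<in> borel_measurable M"
    and sq: "integrable M (\<lambda>x. (f x)\<^sup>2)"
  shows "(\<integral>x. (f x - (\<integral>z. f z \<partial>M))\<^sup>2 \<partial>M) \<le> (\<integral>x. (f x - c)\<^sup>2 \<partial>M)"
proof -
  define m where "m = (\<integral>z. f z \<partial>M)"
  have f: "integrable M f" by (rule square_integrable_imp_integrable[OF _ sq]) simp
  have sq': "integrable M (\<lambda>x. (f x - b)\<^sup>2)" for b
    using f sq by (auto simp: power2_diff)
  have "(\<integral>x. (f x - c)\<^sup>2 \<partial>M) = (\<integral>x. (f x - m)\<^sup>2 + (2 * (m - c) * (f x - m) + (m - c)\<^sup>2) \<partial>M)"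
    by (intro Bochner_Integration.integral_cong) (auto simp: power2_eq_square algebra_simps)
  also have "\<dots> = (\<integral>x. (f x - m)\<^sup>2 \<partial>M) + (m - c)\<^sup>2"
    using f sq' total by (simp add: m_def[symmetric])
  finally show ?thesis unfolding m_def by simp
qed

section \<open>The speed measure and its tails\<close>

locale nash_setting =
  fixes \<alpha> \<epsilon> :: real and a :: "real \<Rightarrow> real"
  assumes alpha: "1 < \<alpha>" "\<alpha> < 2" and eps: "2 < \<epsilon>"
    and a_pos: "\<And>x. 0 < a x"
    and a_measurable [measurable]: "a \<in> borel_measurable borel"
    and a_int: "has_bochner_integral lborel (\<lambda>x. 1 / a x) 1"
begin

abbreviation "\<mu> \<equiv> speed_measure a"

lemma sets_mu [measurable_cong, simp]: "sets \<mu> = sets borel"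
  by (simp add: speed_measure_def)

lemma space_mu [simp]: "space \<mu> = UNIV"
  by (simp add: speed_measure_def)

lemma emeasure_mu_UNIV: "emeasure \<mu> UNIV = 1"
proof -
  have "emeasure \<mu> UNIV = (\<integral>\<^sup>+x. ennreal (1 / a x) \<partial>lborel)"
    by (simp add: speed_measure_def emeasure_density)
  also have "\<dots> = ennreal 1"
    using a_int a_pos by (subst nn_integral_eq_integral) (auto simp: has_bochner_integral_iff less_imp_le)
  finally show ?thesis by simp
qed

sublocale finite_measure \<mu>
  by standard (simp add: emeasure_mu_UNIV)

lemma measure_mu_UNIV [simp]: "measure \<mu> UNIV = 1"
  by (simp add: measure_def emeasure_mu_UNIV)

lemma measure_mu_le_1: "measure \<mu> S \<le> 1"
  using bounded_measure[of S] by simp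

lemma AE_mu: "AE x in lborel. P x \<Longrightarrow> AE x in \<mu>. P x"
  unfolding speed_measure_def by (subst AE_density) (auto elim: eventually_mono)

text \<open>The density is positive and the interval is not Lebesgue null. This mass is a divisor in
  the choice of the base point.\<close>

lemma unit_interval_pos: "0 < measure \<mu> {-1..1}"
proof (rule ccontr)
  assume "\<not> ?thesis"
  then have "measure \<mu> {-1..1} = 0" using measure_nonneg[of \<mu> "{-1..1}"] by linarith
  then have "{-1..1} \<in> null_sets \<mu>" by (intro null_setsI) (auto simp: emeasure_eq_measure)
  then have "AE x in lborel. x \<in> {-1..1} \<longrightarrow> ennreal (1 / a x) = 0"
    by (simp add: speed_measure_def null_sets_density_iff)
  then have "AE x in lborel. x \<notin> {-1..1::real}"
  proof (rule eventually_mono)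
    show "x \<notin> {-1..1}" if "x \<in> {-1..1} \<longrightarrow> ennreal (1 / a x) = 0" for x
      using that a_pos[of x] by (auto simp: ennreal_eq_0_iff)
  qed
  then have "{-1..1::real} \<in> null_sets lborel"
    by (simp add: AE_iff_null_sets)
  then show False by (simp add: null_sets_def)
qed

definition tail :: "real \<Rightarrow> real" where
  "tail r = measure \<mu> (- {-r<..<r})"

lemma tail_nonneg: "0 \<le> tail r" and tail_le_1: "tail r \<le> 1"
  by (simp_all add: tail_def measure_mu_le_1)

lemma tail_antimono: "r \<le> s \<Longrightarrow> tail s \<le> tail r"
  unfolding tail_def by (intro finite_measure_mono) auto

text \<open>For \<open>s \<ge> 2\<close> the set lies outside the interval of radius
  \<open>s - 1 \<ge> s / 2\<close>. For smaller \<open>s\<close> the mass is at most 1 and the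
  right-hand side at least 1, thanks to \<open>B \<ge> 1\<close>.\<close>

lemma tail_bound_shift:
  assumes B: "\<And>r. 0 < r \<Longrightarrow> r powr (\<alpha> - 1) * tail r powr ((\<epsilon> - 2) / \<epsilon>) \<le> B" and B1: "1 \<le> B" and s: "0 < s"
  shows "measure \<mu> {x. s < 1 + \<bar>x\<bar>} powr ((\<epsilon> - 2) / \<epsilon>) \<le> B * 2 powr (\<alpha> - 1) / s powr (\<alpha> - 1)"
proof (cases "2 \<le> s")
  case True
  have "measure \<mu> {x. s < 1 + \<bar>x\<bar>} \<le> tail (s / 2)"
    unfolding tail_def using True by (intro finite_measure_mono) auto
  then have "measure \<mu> {x. s < 1 + \<bar>x\<bar>} powr ((\<epsilon> - 2) / \<epsilon>) \<le> tail (s / 2) powr ((\<epsilon> - 2) / \<epsilon>)"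
    using eps by (intro powr_mono2) auto
  also have "\<dots> \<le> B / (s / 2) powr (\<alpha> - 1)"
    using B[of "s / 2"] s by (simp add: field_simps)
  also have "\<dots> = B * 2 powr (\<alpha> - 1) / s powr (\<alpha> - 1)"
    using s by (simp add: powr_divide)
  finally show ?thesis .
next
  case False
  have "measure \<mu> {x. s < 1 + \<bar>x\<bar>} powr ((\<epsilon> - 2) / \<epsilon>) \<le> 1 powr ((\<epsilon> - 2) / \<epsilon>)"
    using eps by (intro powr_mono2) (auto simp: measure_mu_le_1)
  also have "\<dots> \<le> 2 powr (\<alpha> - 1) / s powr (\<alpha> - 1)"
    using False s alpha by (simp add: powr_mono2)
  also have "\<dots> \<le> B * (2 powr (\<alpha> - 1) / s powr (\<alpha> - 1))"
    using B1 by (intro mult_right_mono[of 1 B, simplified]) auto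
  finally show ?thesis by simp
qed

text \<open>The growth bound and the tail condition place \<open>h\<close> in weak Lebesgue space of
  exponent \<open>p\<close>, with constant \<open>L powr (p / 2)\<close>; interpolation with the
  first moment does the rest.\<close>

lemma second_moment_bound:
  assumes B: "\<And>r. 0 < r \<Longrightarrow> r powr (\<alpha> - 1) * tail r powr ((\<epsilon> - 2) / \<epsilon>) \<le> B" and B1: "1 \<le> B"
    and h: "integrable \<mu> h" and H: "0 \<le> H" and bd: "AE x in \<mu>. (h x)\<^sup>2 \<le> H * (1 + \<bar>x\<bar>) powr (\<alpha> - 1)"
  defines "p \<equiv> 2 * \<epsilon> / (\<epsilon> - 2)"
  shows "(\<integral>x. (h x)\<^sup>2 \<partial>\<mu>) powr ((\<epsilon> + 2) / \<epsilon>)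
    \<le> (2 + 2 / (p - 2)) powr ((\<epsilon> + 2) / \<epsilon>) * (\<integral>x. \<bar>h x\<bar> \<partial>\<mu>) powr (4 / \<epsilon>) * (B * 2 powr (\<alpha> - 1) * H)"
proof -
  have [measurable]: "h \<in> borel_measurable borel"
    using borel_measurable_integrable[OF h] by (simp cong: measurable_cong_sets)
  define L where "L = B * 2 powr (\<alpha> - 1) * H"
  have L: "0 \<le> L" unfolding L_def using B1 H by simp
  have p: "2 < p" "p - 1 = (\<epsilon> + 2) / (\<epsilon> - 2)" "p - 2 = 4 / (\<epsilon> - 2)" "p / 2 = \<epsilon> / (\<epsilon> - 2)"
    unfolding p_def using eps by (auto simp: field_simps)
  have tail: "emeasure \<mu> {x \<in> space \<mu>. s < \<bar>h x\<bar>} \<le> ennreal (L powr (p / 2) * s powr (- p))" if s: "0 < s" for s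
  proof -
    have "measure \<mu> {x. s < \<bar>h x\<bar>} powr ((\<epsilon> - 2) / \<epsilon>) \<le> L / s\<^sup>2"
    proof (cases "H = 0")
      case True
      then have "AE x in \<mu>. \<not> s < \<bar>h x\<bar>" using bd s by auto
      then have "measure \<mu> {x. s < \<bar>h x\<bar>} = measure \<mu> {}"
        by (intro measure_eq_AE) auto
      then show ?thesis using L by simp
    next
      case False
      then have Hp: "0 < H" using H by simp
      \<comment> \<open>The value of \<open>1 + \<bar>x\<bar>\<close> at which the majorant of the
        square of \<open>h\<close> reaches the square of \<open>s\<close>.\<close>
      define \<rho> where "\<rho> = (s\<^sup>2 / H) powr (1 / (\<alpha> - 1))"
      have \<rho>: "0 < \<rho>" "\<rho> powr (\<alpha> - 1) = s\<^sup>2 / H"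
        using Hp s alpha by (auto simp: \<rho>_def powr_powr)
      have "AE x in \<mu>. x \<in> {x. s < \<bar>h x\<bar>} \<longrightarrow> x \<in> {x. \<rho> < 1 + \<bar>x\<bar>}"
        using bd
      proof eventually_elim
        case (elim x)
        show ?case
        proof (intro impI, rule ccontr)
          assume *: "x \<in> {x. s < \<bar>h x\<bar>}" "x \<notin> {x. \<rho> < 1 + \<bar>x\<bar>}"
          have "s\<^sup>2 < \<bar>h x\<bar>\<^sup>2" using * s by (intro power_strict_mono) auto
          moreover have "(1 + \<bar>x\<bar>) powr (\<alpha> - 1) \<le> \<rho> powr (\<alpha> - 1)"
            using * alpha by (intro powr_mono2) auto
          then have "H * (1 + \<bar>x\<bar>) powr (\<alpha> - 1) \<le> s\<^sup>2"
            using Hp unfolding \<rho>(2) by (simp add: field_simps)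
          ultimately show False using elim by simp
        qed
      qed
      then have "measure \<mu> {x. s < \<bar>h x\<bar>} \<le> measure \<mu> {x. \<rho> < 1 + \<bar>x\<bar>}"
        by (intro finite_measure_mono_AE) auto
      then have "measure \<mu> {x. s < \<bar>h x\<bar>} powr ((\<epsilon> - 2) / \<epsilon>) \<le> measure \<mu> {x. \<rho> < 1 + \<bar>x\<bar>} powr ((\<epsilon> - 2) / \<epsilon>)"
        using eps by (intro powr_mono2) auto
      also have "\<dots> \<le> B * 2 powr (\<alpha> - 1) / \<rho> powr (\<alpha> - 1)"
        by (intro tail_bound_shift B B1 \<rho>)
      finally show ?thesis unfolding \<rho>(2) L_def by simp
    qed
    then have "(measure \<mu> {x. s < \<bar>h x\<bar>} powr ((\<epsilon> - 2) / \<epsilon>)) powr (p / 2) \<le> (L / s\<^sup>2) powr (p / 2)"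
      using p(1) by (intro powr_mono2) auto
    also have "(measure \<mu> {x. s < \<bar>h x\<bar>} powr ((\<epsilon> - 2) / \<epsilon>)) powr (p / 2) = measure \<mu> {x. s < \<bar>h x\<bar>}"
      using eps unfolding p by (simp add: powr_powr)
    also have "(L / s\<^sup>2) powr (p / 2) = L powr (p / 2) * s powr (- p)"
    proof -
      have "s\<^sup>2 powr (p / 2) = (s powr 2) powr (p / 2)" using s by simp
      also have "\<dots> = s powr p" by (simp only: powr_powr) simp
      finally show ?thesis using s L by (simp add: powr_divide powr_minus_divide)
    qed
    finally show ?thesis by (simp add: emeasure_eq_measure)
  qed
  have "(\<integral>x. (h x)\<^sup>2 \<partial>\<mu>) powr (p - 1)
     \<le> (2 + 2 / (p - 2)) powr (p - 1) * (\<integral>x. \<bar>h x\<bar> \<partial>\<mu>) powr (p - 2) * L powr (p / 2)"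
    by (rule weak_Lp_L1_interpolation) (use h p tail in \<open>auto intro: sigma_finite_measure_axioms\<close>)
  \<comment> \<open>This power, the reciprocal of \<open>p / 2\<close>, makes the bound linear in
    \<open>L\<close>, hence in the energy, and turns the other exponents into those of Nash.\<close>
  then have "((\<integral>x. (h x)\<^sup>2 \<partial>\<mu>) powr (p - 1)) powr ((\<epsilon> - 2) / \<epsilon>)
     \<le> ((2 + 2 / (p - 2)) powr (p - 1) * (\<integral>x. \<bar>h x\<bar> \<partial>\<mu>) powr (p - 2) * L powr (p / 2)) powr ((\<epsilon> - 2) / \<epsilon>)"
    using eps by (intro powr_mono2) auto
  also have "\<dots> = (2 + 2 / (p - 2)) powr ((p - 1) * ((\<epsilon> - 2) / \<epsilon>)) *
      (\<integral>x. \<bar>h x\<bar> \<partial>\<mu>) powr ((p - 2) * ((\<epsilon> - 2) / \<epsilon>)) * L powr (p / 2 * ((\<epsilon> - 2) / \<epsilon>))"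
    using L p(1) by (simp only: powr_mult powr_powr powr_ge_zero mult_nonneg_nonneg)
  also have "((\<integral>x. (h x)\<^sup>2 \<partial>\<mu>) powr (p - 1)) powr ((\<epsilon> - 2) / \<epsilon>) = (\<integral>x. (h x)\<^sup>2 \<partial>\<mu>) powr ((p - 1) * ((\<epsilon> - 2) / \<epsilon>))"
    by (simp only: powr_powr)
  also have "(p - 1) * ((\<epsilon> - 2) / \<epsilon>) = (\<epsilon> + 2) / \<epsilon>" unfolding p using eps by simp
  also have "(p - 2) * ((\<epsilon> - 2) / \<epsilon>) = 4 / \<epsilon>" unfolding p using eps by (simp add: divide_simps)
  also have "p / 2 * ((\<epsilon> - 2) / \<epsilon>) = 1" unfolding p using eps by (simp add: divide_simps)
  finally show ?thesis using L by (simp add: L_def)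
qed

section \<open>From the tail condition to the Nash inequality\<close>

lemma domainD:
  assumes "f \<in> dirichlet_domain \<alpha> \<mu>"
  shows "f \<in> borel_measurable borel" "integrable \<mu> (\<lambda>x. (f x)\<^sup>2)" "integrable \<mu> f"
    "(\<integral>\<^sup>+x. stable_potential \<alpha> f x \<partial>lborel) = ennreal (2 * dirichlet_form \<alpha> f f)" "0 \<le> dirichlet_form \<alpha> f f"
proof -
  show f [measurable]: "f \<in> borel_measurable borel" and sq: "integrable \<mu> (\<lambda>x. (f x)\<^sup>2)"
    using assms by (auto simp: dirichlet_domain_def cong: measurable_cong_sets)
  show "integrable \<mu> f"
    by (rule square_integrable_imp_integrable[OF _ sq]) simp
  show E0: "0 \<le> dirichlet_form \<alpha> f f"
    unfolding dirichlet_form_def using stable_const_pos[of \<alpha>] alpha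
    by (intro mult_nonneg_nonneg integral_nonneg) (auto simp: stable_integrand_def)
  have "1 / 2 * (\<integral>\<^sup>+x. stable_potential \<alpha> f x \<partial>lborel) = ennreal (dirichlet_form \<alpha> f f)"
    using stable_energy_eq_dirichlet_form[OF _ _ assms] alpha
    unfolding stable_energy_def stable_potential_def by simp
  then have "2 * (1 / 2 * (\<integral>\<^sup>+x. stable_potential \<alpha> f x \<partial>lborel)) = ennreal (2 * dirichlet_form \<alpha> f f)"
    using E0 by (simp add: ennreal_mult)
  moreover have "2 * (1 / 2 * z) = z" for z :: ennreal
  proof -
    have "(1 / 2 :: ennreal) = ennreal (1 / 2)"
      using divide_ennreal[of 1 2] by simp
    moreover have "ennreal 2 * ennreal (1 / 2) = ennreal (2 * (1 / 2))"
      by (intro ennreal_mult[symmetric]) auto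
    ultimately have "2 * (1 / 2) = (1::ennreal)" by simp
    then show ?thesis by (simp add: mult.assoc[symmetric])
  qed
  ultimately show "(\<integral>\<^sup>+x. stable_potential \<alpha> f x \<partial>lborel) = ennreal (2 * dirichlet_form \<alpha> f f)"
    by simp
qed

text \<open>Otherwise \<open>\<bar>f\<bar>\<close> would exceed the quotient almost everywhere on
  the interval, whose mass is positive, and its integral there would exceed the full one. Taking
  finiteness of the potential for \<open>P\<close> gives a usable base point.\<close>

lemma exists_small_value:
  assumes f: "integrable \<mu> f" and P: "AE x in \<mu>. P x"
  shows "\<exists>x\<in>{-1..1}. P x \<and> \<bar>f x\<bar> \<le> (\<integral>z. \<bar>f z\<bar> \<partial>\<mu>) / measure \<mu> {-1..1}"
proof (rule ccontr)
  let ?J = "{-1..1::real}"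
  define N where "N = (\<integral>z. \<bar>f z\<bar> \<partial>\<mu>)"
  define c where "c = N / measure \<mu> ?J"
  assume contr: "\<not> ?thesis"
  have gt: "AE x in \<mu>. x \<in> ?J \<longrightarrow> c < \<bar>f x\<bar>"
    using P by eventually_elim (use contr in \<open>auto simp: c_def N_def not_le\<close>)
  have "(\<integral>x. c * indicator ?J x \<partial>\<mu>) < (\<integral>x. \<bar>f x\<bar> * indicator ?J x \<partial>\<mu>)"
  proof (rule integral_less_AE[where A="?J"])
    show "AE x in \<mu>. x \<in> ?J \<longrightarrow> c * indicator ?J x \<noteq> \<bar>f x\<bar> * indicator ?J x"
      using gt by eventually_elim auto
    show "AE x in \<mu>. c * indicator ?J x \<le> \<bar>f x\<bar> * indicator ?J x"
      using gt by eventually_elim (auto split: split_indicator)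
  qed (use f unit_interval_pos in \<open>auto simp: emeasure_eq_measure intro!: integrable_real_mult_indicator\<close>)
  also have "\<dots> \<le> N"
    unfolding N_def using f by (intro integral_mono integrable_real_mult_indicator) (auto split: split_indicator)
  also have "N = (\<integral>x. c * indicator ?J x \<partial>\<mu>)"
    using unit_interval_pos by (simp add: c_def)
  finally show False by simp
qed

lemma Lp_norm_2_powr:
  assumes "f \<in> borel_measurable \<mu>"
  shows "Lp_norm 2 \<mu> f powr (2 + 4 / \<epsilon>) = (\<integral>x. (f x)\<^sup>2 \<partial>\<mu>) powr ((\<epsilon> + 2) / \<epsilon>)"
proof -
  have "\<bar>f x\<bar> powr 2 = (f x)\<^sup>2" for x
    by (cases "f x = 0") auto
  then show ?thesis
    unfolding Lp_norm_def using eps by (simp add: powr_powr add_divide_distrib)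
qed

lemma Lp_norm_1: "Lp_norm 1 \<mu> f = (\<integral>x. \<bar>f x\<bar> \<partial>\<mu>)"
  unfolding Lp_norm_def by simp

lemma tail_bound_imp_nash:
  assumes "\<And>r. 0 < r \<Longrightarrow> r powr (\<alpha> - 1) * tail r powr ((\<epsilon> - 2) / \<epsilon>) \<le> B0"
  shows "nash_inequality \<epsilon> \<mu> (dirichlet_form \<alpha>) (dirichlet_domain \<alpha> \<mu>)"
proof -
  define B where "B = max 1 B0"
  have B1: "1 \<le> B" and B: "\<And>r. 0 < r \<Longrightarrow> r powr (\<alpha> - 1) * tail r powr ((\<epsilon> - 2) / \<epsilon>) \<le> B"
    using assms by (auto simp: B_def le_max_iff_disj)
  define p where "p = 2 * \<epsilon> / (\<epsilon> - 2)"
  define w where "w = measure \<mu> {-1..1}"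
  \<comment> \<open>The factors are the interpolation constant, the cost \<open>1 + 1 / w\<close> of
    subtracting \<open>f z\<close> in the first moment, and the weak bound; the last 2 arises
    because the potential integrates to twice the form.\<close>
  define C where "C = (2 + 2 / (p - 2)) powr ((\<epsilon> + 2) / \<epsilon>) * (1 + 1 / w) powr (4 / \<epsilon>) *
     (B * 2 powr (\<alpha> - 1) * (holder_const \<alpha> * 2))"
  have w: "0 < w" using unit_interval_pos by (simp add: w_def)
  have p: "2 < p" using eps by (simp add: p_def field_simps)
  have C: "0 < C"
  proof -
    have "0 < 2 + 2 / (p - 2)" "0 < 1 + 1 / w" using p w by (auto intro: add_pos_pos)
    then show ?thesis
      unfolding C_def using B1 holder_const_pos[of \<alpha>] alpha by (intro mult_pos_pos) auto
  qed
  have "Lp_norm 2 \<mu> (\<lambda>x. f x - (\<integral>z. f z \<partial>\<mu>)) powr (2 + 4 / \<epsilon>)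
          \<le> inverse (inverse C) * dirichlet_form \<alpha> f f * Lp_norm 1 \<mu> f powr (4 / \<epsilon>)"
    if dom: "f \<in> dirichlet_domain \<alpha> \<mu>" for f
  proof -
    note f = domainD[OF dom]
    have [measurable]: "f \<in> borel_measurable borel" by fact
    define E where "E = dirichlet_form \<alpha> f f"
    define N where "N = (\<integral>x. \<bar>f x\<bar> \<partial>\<mu>)"
    have E: "0 \<le> E" using f(5) by (simp add: E_def)
    have N: "0 \<le> N" by (simp add: N_def)
    have [measurable]: "stable_potential \<alpha> f \<in> borel_measurable borel"
      unfolding stable_potential_def[abs_def] stable_integrand_def by measurable
    have "AE x in lborel. stable_potential \<alpha> f x \<noteq> \<infinity>"
      using f(4) by (intro nn_integral_PInf_AE) auto
    then have fin: "AE x in \<mu>. stable_potential \<alpha> f x < \<infinity>"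
      by (intro AE_mu) (simp add: less_top)
    obtain z where z: "z \<in> {-1..1}" "stable_potential \<alpha> f z < \<infinity>" "\<bar>f z\<bar> \<le> N / w"
      using exists_small_value[OF f(3) fin] unfolding N_def w_def by blast
    let ?h = "\<lambda>x. f x - f z"
    have "AE x in \<mu>. (?h x)\<^sup>2 \<le> (holder_const \<alpha> * (2 * E)) * (1 + \<bar>x\<bar>) powr (\<alpha> - 1)"
      using fin
    proof eventually_elim
      case (elim x)
      have "(?h x)\<^sup>2 \<le> holder_const \<alpha> * (2 * E) * \<bar>x - z\<bar> powr (\<alpha> - 1)"
        by (rule increment_le_holder) (use alpha f E elim z in \<open>auto simp: E_def\<close>)
      also have "\<dots> \<le> holder_const \<alpha> * (2 * E) * (1 + \<bar>x\<bar>) powr (\<alpha> - 1)"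
        using holder_const_pos[of \<alpha>] alpha E z by (intro mult_left_mono powr_mono2) auto
      finally show ?case .
    qed
    moreover have h: "integrable \<mu> ?h" using f(3) by auto
    ultimately have "(\<integral>x. (?h x)\<^sup>2 \<partial>\<mu>) powr ((\<epsilon> + 2) / \<epsilon>)
      \<le> (2 + 2 / (p - 2)) powr ((\<epsilon> + 2) / \<epsilon>) * (\<integral>x. \<bar>?h x\<bar> \<partial>\<mu>) powr (4 / \<epsilon>) *
         (B * 2 powr (\<alpha> - 1) * (holder_const \<alpha> * (2 * E)))"
      unfolding p_def using E holder_const_pos[of \<alpha>] alpha
      by (intro second_moment_bound B B1) auto
    also have "\<dots> \<le> (2 + 2 / (p - 2)) powr ((\<epsilon> + 2) / \<epsilon>) * ((1 + 1 / w) * N) powr (4 / \<epsilon>) *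
         (B * 2 powr (\<alpha> - 1) * (holder_const \<alpha> * (2 * E)))"
    proof -
      have "(\<integral>x. \<bar>?h x\<bar> \<partial>\<mu>) \<le> (\<integral>x. \<bar>f x\<bar> + \<bar>f z\<bar> \<partial>\<mu>)"
        using f(3) h by (intro integral_mono) auto
      also have "\<dots> = N + \<bar>f z\<bar>" using f(3) by (simp add: N_def)
      also have "\<dots> \<le> (1 + 1 / w) * N" using z(3) by (simp add: algebra_simps)
      finally have "(\<integral>x. \<bar>?h x\<bar> \<partial>\<mu>) powr (4 / \<epsilon>) \<le> ((1 + 1 / w) * N) powr (4 / \<epsilon>)"
        using eps by (intro powr_mono2) auto
      then show ?thesis
        using E holder_const_pos[of \<alpha>] alpha B1 by (intro mult_right_mono mult_left_mono) auto
    qed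
    also have "\<dots> = C * E * N powr (4 / \<epsilon>)"
      unfolding C_def using w N by (simp add: powr_mult)
    finally have le: "(\<integral>x. (?h x)\<^sup>2 \<partial>\<mu>) powr ((\<epsilon> + 2) / \<epsilon>) \<le> C * E * N powr (4 / \<epsilon>)" .
    have "Lp_norm 2 \<mu> (\<lambda>x. f x - (\<integral>z. f z \<partial>\<mu>)) powr (2 + 4 / \<epsilon>)
        = (\<integral>x. (f x - (\<integral>z. f z \<partial>\<mu>))\<^sup>2 \<partial>\<mu>) powr ((\<epsilon> + 2) / \<epsilon>)"
      by (intro Lp_norm_2_powr) auto
    also have "\<dots> \<le> (\<integral>x. (?h x)\<^sup>2 \<partial>\<mu>) powr ((\<epsilon> + 2) / \<epsilon>)"
      using eps f by (intro powr_mono2 variance_le_second_moment) auto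
    finally show ?thesis using le by (simp add: Lp_norm_1 E_def N_def)
  qed
  then show ?thesis
    unfolding nash_inequality_def using C by (intro exI[of _ "inverse C"]) auto
qed

end

section \<open>Necessity of the tail condition\<close>

definition cutoff :: "real \<Rightarrow> real \<Rightarrow> real" where
  "cutoff r x = min 1 (max 0 (2 * \<bar>x\<bar> / r - 1))"

lemma cutoff_measurable [measurable]: "cutoff r \<in> borel_measurable borel"
  unfolding cutoff_def by measurable

lemma cutoff_nonneg: "0 \<le> cutoff r x" and cutoff_le_1: "cutoff r x \<le> 1"
  by (auto simp: cutoff_def)

lemma cutoff_eq_1: "0 < r \<Longrightarrow> r \<le> \<bar>x\<bar> \<Longrightarrow> cutoff r x = 1"
  by (simp add: cutoff_def field_simps)

lemma cutoff_eq_0: "0 < r \<Longrightarrow> \<bar>x\<bar> \<le> r / 2 \<Longrightarrow> cutoff r x = 0"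
  by (simp add: cutoff_def field_simps)

lemma cutoff_increment:
  assumes "0 < r"
  shows "\<bar>cutoff r x - cutoff r y\<bar> \<le> 2 * \<bar>x - y\<bar> / r"
proof -
  have "\<bar>cutoff r x - cutoff r y\<bar> \<le> \<bar>(2 * \<bar>x\<bar> / r - 1) - (2 * \<bar>y\<bar> / r - 1)\<bar>"
    unfolding cutoff_def by linarith
  also have "(2 * \<bar>x\<bar> / r - 1) - (2 * \<bar>y\<bar> / r - 1) = 2 / r * (\<bar>x\<bar> - \<bar>y\<bar>)"
    by (simp add: right_diff_distrib)
  also have "\<bar>2 / r * (\<bar>x\<bar> - \<bar>y\<bar>)\<bar> = 2 / r * \<bar>\<bar>x\<bar> - \<bar>y\<bar>\<bar>"
    unfolding abs_mult using assms by simp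
  also have "\<dots> \<le> 2 / r * \<bar>x - y\<bar>"
    using assms by (intro mult_left_mono) auto
  finally show ?thesis by simp
qed

text \<open>Two points outside \<open>{-r..r}\<close> contribute nothing. For a pair with a point in
  this interval of length \<open>2 * r\<close>, integrating the other variable costs order
  \<open>r powr (- \<alpha>)\<close>.\<close>

lemma cutoff_energy:
  assumes \<alpha>: "1 < \<alpha>" "\<alpha> < 2" and r: "0 < r"
  shows "(\<integral>\<^sup>+x. stable_potential \<alpha> (cutoff r) x \<partial>lborel)
     \<le> ennreal (8 * stable_const \<alpha> * (4 / (2 - \<alpha>) + 1 / \<alpha>) * r powr (1 - \<alpha>))"
proof -
  let ?c = "stable_const \<alpha>" and ?J = "{-r..r}"
  have c: "0 < ?c" using \<alpha> by (intro stable_const_pos) auto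
  \<comment> \<open>A majorant depending on the distance only: up to \<open>r\<close> it uses the
    Lipschitz constant \<open>2 / r\<close>, beyond \<open>r\<close> that increments are at most
    1.\<close>
  define g where "g t = ennreal ?c * (ennreal (4 / r\<^sup>2) * (ennreal (t powr (1 - \<alpha>)) * indicator {0..r} t)
    + ennreal (t powr (- (1 + \<alpha>))) * indicator {r..} t)" for t
  have [measurable]: "g \<in> borel_measurable borel" unfolding g_def[abs_def] by measurable
  define G where "G = ?c * (4 / (2 - \<alpha>) + 1 / \<alpha>) * r powr (- \<alpha>)"
  have G0: "0 \<le> G" unfolding G_def using c \<alpha> by simp
  have G: "(\<integral>\<^sup>+t. g t \<partial>lborel) = ennreal G"
  proof -
    have "r powr (2 - \<alpha>) = r\<^sup>2 * r powr (- \<alpha>)"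
      using r powr_add[of r 2 "- \<alpha>"] by simp
    then have e: "4 / r\<^sup>2 * (r powr (2 - \<alpha>) / (2 - \<alpha>)) + r powr (- \<alpha>) / \<alpha> = (4 / (2 - \<alpha>) + 1 / \<alpha>) * r powr (- \<alpha>)"
      using r by (simp add: algebra_simps)
    have "(\<integral>\<^sup>+t. g t \<partial>lborel) = ennreal ?c * (ennreal (4 / r\<^sup>2) * ennreal (r powr (2 - \<alpha>) / (2 - \<alpha>))
      + ennreal (r powr (- \<alpha>) / \<alpha>))"
      unfolding g_def using nn_integral_powr_atMost[of r "1 - \<alpha>"] nn_integral_powr_atLeast[of r "1 + \<alpha>"] \<alpha> r
      by (simp add: nn_integral_cmult nn_integral_add)
    also have "\<dots> = ennreal (?c * (4 / r\<^sup>2 * (r powr (2 - \<alpha>) / (2 - \<alpha>)) + r powr (- \<alpha>) / \<alpha>))"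
      using c \<alpha> r by (simp add: ennreal_mult[symmetric] ennreal_plus[symmetric] del: ennreal_plus times_divide_eq_left times_divide_eq_right)
    finally show ?thesis unfolding e by (simp add: G_def mult.assoc)
  qed
  have g_ge: "ennreal (stable_integrand \<alpha> (cutoff r) (cutoff r) x y) \<le> g \<bar>x - y\<bar>" if "x \<noteq> y" for x y
  proof -
    define t where "t = \<bar>x - y\<bar>"
    have t: "0 < t" using that by (simp add: t_def)
    have K: "stable_integrand \<alpha> (cutoff r) (cutoff r) x y = \<bar>cutoff r x - cutoff r y\<bar>\<^sup>2 * (?c * t powr (- (1 + \<alpha>)))"
      unfolding stable_integrand_def t_def powr_minus_divide by (simp add: power2_eq_square)
    show ?thesis
    proof (cases "t \<le> r")
      case True
      have "\<bar>cutoff r x - cutoff r y\<bar>\<^sup>2 \<le> (2 * t / r)\<^sup>2"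
        using cutoff_increment[OF r, of x y] unfolding t_def by (intro power_mono) auto
      then have "stable_integrand \<alpha> (cutoff r) (cutoff r) x y \<le> (2 * t / r)\<^sup>2 * (?c * t powr (- (1 + \<alpha>)))"
        unfolding K using c by (intro mult_right_mono) auto
      also have "\<dots> = ?c * (4 / r\<^sup>2 * (t\<^sup>2 * t powr (- (1 + \<alpha>))))"
        by (simp add: power_divide power_mult_distrib)
      also have "t\<^sup>2 * t powr (- (1 + \<alpha>)) = t powr (1 - \<alpha>)"
        using t powr_add[of t 2 "- (1 + \<alpha>)"] by simp
      finally have "ennreal (stable_integrand \<alpha> (cutoff r) (cutoff r) x y) \<le> ennreal (?c * (4 / r\<^sup>2 * t powr (1 - \<alpha>)))"
        by (rule ennreal_leI)
      also have "\<dots> = ennreal ?c * (ennreal (4 / r\<^sup>2) * (ennreal (t powr (1 - \<alpha>)) * indicator {0..r} t))"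
        using c t True by (simp add: ennreal_mult[symmetric])
      also have "\<dots> \<le> g t"
        unfolding g_def by (intro mult_left_mono) auto
      finally show ?thesis by (simp add: t_def)
    next
      case False
      have "\<bar>cutoff r x - cutoff r y\<bar> \<le> 1"
        using cutoff_nonneg[of r x] cutoff_le_1[of r x] cutoff_nonneg[of r y] cutoff_le_1[of r y] by linarith
      then have "\<bar>cutoff r x - cutoff r y\<bar>\<^sup>2 \<le> 1"
        by (simp add: abs_square_le_1)
      then have "stable_integrand \<alpha> (cutoff r) (cutoff r) x y \<le> 1 * (?c * t powr (- (1 + \<alpha>)))"
        unfolding K using c by (intro mult_right_mono) auto
      then have "ennreal (stable_integrand \<alpha> (cutoff r) (cutoff r) x y) \<le> ennreal (?c * t powr (- (1 + \<alpha>)))"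
        by (intro ennreal_leI) simp
      also have "\<dots> = g t"
        unfolding g_def using False c by (simp add: ennreal_mult)
      finally show ?thesis by (simp add: t_def)
    qed
  qed
  \<comment> \<open>Since \<open>g\<close> vanishes on negative arguments, the sum of the two
    reflected terms replaces the absolute value, and each term is integrated by an affine
    substitution.\<close>
  have le: "ennreal (stable_integrand \<alpha> (cutoff r) (cutoff r) x y)
      \<le> indicator ?J x * (g (y - x) + g (x - y)) + indicator ?J y * (g (y - x) + g (x - y))" for x y
  proof (cases "x \<noteq> y \<and> (x \<in> ?J \<or> y \<in> ?J)")
    case True
    have "g \<bar>x - y\<bar> \<le> g (y - x) + g (x - y)"
      by (cases "x \<le> y") (auto simp: abs_if)
    then have "ennreal (stable_integrand \<alpha> (cutoff r) (cutoff r) x y) \<le> g (y - x) + g (x - y)"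
      using g_ge True order_trans by blast
    then show ?thesis using True by (auto intro: add_increasing add_increasing2 simp: indicator_def)
  next
    case False
    then have "cutoff r x = cutoff r y"
      using cutoff_eq_1[OF r, of x] cutoff_eq_1[OF r, of y] by fastforce
    then show ?thesis by (simp add: stable_integrand_def)
  qed
  have shift: "(\<integral>\<^sup>+y. g (y - x) + g (x - y) \<partial>lborel) = ennreal (2 * G)" for x
  proof -
    have "(\<integral>\<^sup>+y. g (y - x) \<partial>lborel) = ennreal G" "(\<integral>\<^sup>+y. g (x - y) \<partial>lborel) = ennreal G"
      using G nn_integral_real_affine[of g 1 "- x"] nn_integral_real_affine[of g "- 1" x] by simp_all
    then show ?thesis using G0 by (subst nn_integral_add) (auto simp: ennreal_plus[symmetric] simp del: ennreal_plus)
  qed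
  have half: "(\<integral>\<^sup>+x. \<integral>\<^sup>+y. indicator ?J x * (g (y - x) + g (x - y)) \<partial>lborel \<partial>lborel) = ennreal (4 * r * G)"
    using r G0 by (simp add: nn_integral_cmult shift nn_integral_multc ennreal_mult[symmetric])
  \<comment> \<open>The summed kernel is symmetric, so exchanging the variables reduces this to
    \<open>half\<close>.\<close>
  have half': "(\<integral>\<^sup>+x. \<integral>\<^sup>+y. indicator ?J y * (g (y - x) + g (x - y)) \<partial>lborel \<partial>lborel) = ennreal (4 * r * G)"
    by (subst lborel_pair.Fubini') (use half in \<open>simp_all add: add.commute\<close>)
  have "(\<integral>\<^sup>+x. stable_potential \<alpha> (cutoff r) x \<partial>lborel)
     \<le> (\<integral>\<^sup>+x. \<integral>\<^sup>+y. indicator ?J x * (g (y - x) + g (x - y)) + indicator ?J y * (g (y - x) + g (x - y)) \<partial>lborel \<partial>lborel)"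
    unfolding stable_potential_def by (intro nn_integral_mono le)
  also have "\<dots> = ennreal (4 * r * G) + ennreal (4 * r * G)"
    by (simp add: nn_integral_add half half' del: nn_integral_indicator_singleton)
  also have "\<dots> = ennreal (8 * (r * G))"
    using r G0 by (simp add: ennreal_plus[symmetric] del: ennreal_plus)
  also have "r * G = ?c * (4 / (2 - \<alpha>) + 1 / \<alpha>) * r powr (1 - \<alpha>)"
    using r powr_add[of r 1 "- \<alpha>"] by (simp add: G_def)
  finally show ?thesis by (simp add: mult.assoc)
qed

section \<open>From the Nash inequality to the tail condition\<close>

context nash_setting
begin

lemma cutoff_domain:
  assumes r: "0 < r"
  shows "cutoff r \<in> dirichlet_domain \<alpha> \<mu>"
proof -
  have sq: "integrable \<mu> (\<lambda>x. (cutoff r x)\<^sup>2)"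
    by (rule integrable_const_bound[of _ 1]) (auto simp: cutoff_nonneg cutoff_le_1 abs_square_le_1)
  have "(\<integral>\<^sup>+x. stable_potential \<alpha> (cutoff r) x \<partial>lborel) < \<infinity>"
    using cutoff_energy[OF alpha r] by (rule order_le_less_trans) simp
  then have "stable_energy \<alpha> (cutoff r) < \<infinity>"
    unfolding stable_energy_def stable_potential_def[symmetric]
    using divide_ennreal[of 1 2] by (simp add: ennreal_mult_eq_top_iff less_top[symmetric])
  then show ?thesis using sq by (simp add: dirichlet_domain_def cong: measurable_cong_sets)
qed

text \<open>Continuity from above of a finite measure. The argument \<open>r / 2\<close> is the
  radius on which the cutoff vanishes, so its mean is at most one half.\<close>

lemma tail_vanishes: "\<exists>R>0. \<forall>r\<ge>R. tail (r / 2) \<le> 1 / 2"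
proof -
  have "(\<lambda>n. measure \<mu> (- {- real n<..<real n})) \<longlonglongrightarrow> measure \<mu> (\<Inter>n. - {- real n<..<real n})"
    by (intro finite_Lim_measure_decseq) (auto simp: decseq_def)
  also have "(\<Inter>n. - {- real n<..<real n}) = {}"
  proof (safe, simp)
    fix x :: real
    assume *: "\<forall>n. - real n < x \<longrightarrow> \<not> x < real n"
    obtain n where "\<bar>x\<bar> < real n" using reals_Archimedean2 by blast
    then have "- real n < x" "x < real n" by auto
    then show False using * by blast
  qed
  finally have "(\<lambda>n. tail (real n)) \<longlonglongrightarrow> 0" by (simp add: tail_def)
  then have "eventually (\<lambda>n. tail (real n) < 1 / 2) sequentially"
    by (rule order_tendstoD) simp
  then obtain n where n: "tail (real n) < 1 / 2" by (auto simp: eventually_sequentially)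
  have "tail (r / 2) \<le> 1 / 2" if "2 * real n + 1 \<le> r" for r
    using tail_antimono[of "real n" "r / 2"] n that by auto
  then show ?thesis by (intro exI[of _ "2 * real n + 1"]) auto
qed

lemma nash_imp_tail_bound:
  assumes "nash_inequality \<epsilon> \<mu> (dirichlet_form \<alpha>) (dirichlet_domain \<alpha> \<mu>)"
  shows "\<exists>B. \<forall>r>0. r powr (\<alpha> - 1) * tail r powr ((\<epsilon> - 2) / \<epsilon>) \<le> B"
proof -
  obtain A where A: "0 < A" and nash: "\<And>f. f \<in> dirichlet_domain \<alpha> \<mu> \<Longrightarrow>
      Lp_norm 2 \<mu> (\<lambda>x. f x - (\<integral>z. f z \<partial>\<mu>)) powr (2 + 4 / \<epsilon>)
          \<le> inverse A * dirichlet_form \<alpha> f f * Lp_norm 1 \<mu> f powr (4 / \<epsilon>)"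
    using assms unfolding nash_inequality_def by blast
  obtain R where R: "0 < R" and half: "\<And>r. R \<le> r \<Longrightarrow> tail (r / 2) \<le> 1 / 2"
    using tail_vanishes by blast
  \<comment> \<open>The first 4 is half of the 8 in the energy bound. The power of 4 comes from the
    variance: the mean is at most 1/2, so the squared deviation is at least 1/4 where the cutoff is
    1.\<close>
  define C where "C = inverse A * (4 * stable_const \<alpha> * (4 / (2 - \<alpha>) + 1 / \<alpha>)) * 4 powr ((\<epsilon> + 2) / \<epsilon>)"
  have C0: "0 \<le> C" unfolding C_def using A alpha stable_const_pos[of \<alpha>] by simp
  have tail_le: "tail r powr ((\<epsilon> + 2) / \<epsilon>) \<le> C * r powr (1 - \<alpha>) * tail (r / 2) powr (4 / \<epsilon>)" if r: "R \<le> r" for r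
  proof -
    have r0: "0 < r" using r R by simp
    let ?f = "cutoff r"
    note f = domainD[OF cutoff_domain[OF r0]]
    define m where "m = (\<integral>x. ?f x \<partial>\<mu>)"
    have N: "(\<integral>x. \<bar>?f x\<bar> \<partial>\<mu>) = m" by (simp add: m_def cutoff_nonneg)
    have m0: "0 \<le> m" unfolding m_def by (simp add: cutoff_nonneg)
    have "m \<le> (\<integral>x. indicator (- {- (r/2)<..<r/2}) x \<partial>\<mu>)"
      unfolding m_def using f
      by (intro integral_mono) (auto simp: cutoff_le_1 cutoff_eq_0[OF r0] emeasure_eq_measure split: split_indicator)
    then have m: "m \<le> tail (r / 2)" by (simp add: tail_def)
    have "tail r / 4 = (\<integral>x. 1 / 4 * indicator (- {- r<..<r}) x \<partial>\<mu>)"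
      by (simp add: tail_def)
    also have "\<dots> \<le> (\<integral>x. (?f x - m)\<^sup>2 \<partial>\<mu>)"
    proof (intro integral_mono)
      show "integrable \<mu> (\<lambda>x. (?f x - m)\<^sup>2)" using f(2,3) by (simp add: power2_diff)
      show "1 / 4 * indicator (- {- r<..<r}) x \<le> (?f x - m)\<^sup>2" for x
      proof (cases "x \<in> - {-r<..<r}")
        case True
        have "(1 / 2)\<^sup>2 \<le> (1 - m)\<^sup>2" using m half[OF r] by (intro power_mono) auto
        moreover have "?f x = 1" using True by (intro cutoff_eq_1 r0) auto
        ultimately show ?thesis using True by (simp add: power2_eq_square)
      qed simp
    qed (simp add: emeasure_eq_measure)
    finally have "(tail r / 4) powr ((\<epsilon> + 2) / \<epsilon>) \<le> (\<integral>x. (?f x - m)\<^sup>2 \<partial>\<mu>) powr ((\<epsilon> + 2) / \<epsilon>)"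
      using eps tail_nonneg by (intro powr_mono2) auto
    also have "\<dots> = Lp_norm 2 \<mu> (\<lambda>x. ?f x - (\<integral>z. ?f z \<partial>\<mu>)) powr (2 + 4 / \<epsilon>)"
      unfolding m_def by (rule Lp_norm_2_powr[symmetric]) simp
    also have "\<dots> \<le> inverse A * dirichlet_form \<alpha> ?f ?f * m powr (4 / \<epsilon>)"
      using nash[OF cutoff_domain[OF r0]] by (simp add: Lp_norm_1 N)
    also have "\<dots> \<le> inverse A * (4 * stable_const \<alpha> * (4 / (2 - \<alpha>) + 1 / \<alpha>) * r powr (1 - \<alpha>)) * tail (r / 2) powr (4 / \<epsilon>)"
    proof -
      have "ennreal (2 * dirichlet_form \<alpha> ?f ?f) \<le> ennreal (8 * stable_const \<alpha> * (4 / (2 - \<alpha>) + 1 / \<alpha>) * r powr (1 - \<alpha>))"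
        using cutoff_energy[OF alpha r0] unfolding f(4) .
      then have "2 * dirichlet_form \<alpha> ?f ?f \<le> 8 * stable_const \<alpha> * (4 / (2 - \<alpha>) + 1 / \<alpha>) * r powr (1 - \<alpha>)"
        using alpha stable_const_pos[of \<alpha>] by (subst (asm) ennreal_le_iff) auto
      then have "dirichlet_form \<alpha> ?f ?f \<le> 4 * stable_const \<alpha> * (4 / (2 - \<alpha>) + 1 / \<alpha>) * r powr (1 - \<alpha>)"
        by linarith
      note le = this order_trans[OF f(5) this]
      show ?thesis
      proof (rule mult_mono)
        show "m powr (4 / \<epsilon>) \<le> tail (r / 2) powr (4 / \<epsilon>)"
          using m m0 eps by (intro powr_mono2) auto
        show "inverse A * dirichlet_form \<alpha> ?f ?f
            \<le> inverse A * (4 * stable_const \<alpha> * (4 / (2 - \<alpha>) + 1 / \<alpha>) * r powr (1 - \<alpha>))"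
          by (rule mult_left_mono[OF le(1)]) (use A in simp)
        show "0 \<le> inverse A * (4 * stable_const \<alpha> * (4 / (2 - \<alpha>) + 1 / \<alpha>) * r powr (1 - \<alpha>))"
          by (rule mult_nonneg_nonneg[OF _ le(2)]) (use A in simp)
      qed simp
    qed
    finally have "tail r powr ((\<epsilon> + 2) / \<epsilon>) / 4 powr ((\<epsilon> + 2) / \<epsilon>) \<le> \<dots>"
      using tail_nonneg by (simp add: powr_divide)
    then show ?thesis by (simp add: C_def field_simps)
  qed
  define g where "g r = r powr (\<alpha> - 1) * tail r powr ((\<epsilon> - 2) / \<epsilon>)" for r
  have g0: "0 \<le> g r" for r by (simp add: g_def)
  \<comment> \<open>in terms of \<open>g\<close> the powers of \<open>r\<close> in the recursion cancel\<close>
  define b where "b = 4 / (\<epsilon> - 2)"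
  have b: "0 < b" "(\<epsilon> - 2) / \<epsilon> * (b + 1) = (\<epsilon> + 2) / \<epsilon>" "(\<epsilon> - 2) / \<epsilon> * b = 4 / \<epsilon>"
    using eps by (auto simp: b_def divide_simps algebra_simps)
  \<comment> \<open>The additional factor is the price of passing from powers of \<open>r\<close> to
    powers of \<open>r / 2\<close>.\<close>
  define C' where "C' = C * 2 powr ((\<alpha> - 1) * b)"
  have rec: "g r powr (b + 1) \<le> C' * g (r / 2) powr b" if r: "R \<le> r" for r
  proof -
    have r0: "0 < r" using r R by simp
    have "g r powr (b + 1) = r powr ((\<alpha> - 1) * (b + 1)) * tail r powr ((\<epsilon> + 2) / \<epsilon>)"
      unfolding g_def by (simp only: powr_mult powr_ge_zero powr_powr b)
    also have "\<dots> \<le> r powr ((\<alpha> - 1) * (b + 1)) * (C * r powr (1 - \<alpha>) * tail (r / 2) powr (4 / \<epsilon>))"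
      by (intro mult_left_mono tail_le r) auto
    also have "\<dots> = C * (r powr ((\<alpha> - 1) * (b + 1)) * r powr (1 - \<alpha>)) * tail (r / 2) powr (4 / \<epsilon>)"
      by simp
    also have "r powr ((\<alpha> - 1) * (b + 1)) * r powr (1 - \<alpha>) = r powr ((\<alpha> - 1) * b)"
      by (simp add: powr_add[symmetric] algebra_simps)
    also have "r powr ((\<alpha> - 1) * b) = 2 powr ((\<alpha> - 1) * b) * (r / 2) powr ((\<alpha> - 1) * b)"
      using r0 by (simp add: powr_divide)
    also have "C * (2 powr ((\<alpha> - 1) * b) * (r / 2) powr ((\<alpha> - 1) * b)) * tail (r / 2) powr (4 / \<epsilon>)
       = C' * g (r / 2) powr b"
      unfolding g_def C'_def by (simp only: powr_mult powr_ge_zero powr_powr b mult.assoc)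
    finally show ?thesis .
  qed
  \<comment> \<open>A bound preserved by the recursion: \<open>C' \<le> D\<close> turns
    \<open>g (r / 2) \<le> D\<close> into \<open>g r \<le> D\<close>. The other entry starts the
    induction, where the tail is at most 1.\<close>
  define D where "D = max C' (R powr (\<alpha> - 1))"
  have D0: "0 < D" using R by (simp add: D_def less_max_iff_disj)
  have "g r \<le> D" if "0 < r" "r \<le> R * 2 ^ n" for r n
    using that
  proof (induction n arbitrary: r)
    case 0
    have "g r \<le> r powr (\<alpha> - 1) * 1"
      unfolding g_def using tail_nonneg tail_le_1 eps by (intro mult_left_mono powr_le1) auto
    also have "\<dots> \<le> R powr (\<alpha> - 1)"
      using 0 alpha by (simp add: powr_mono2)
    finally show ?case by (simp add: D_def)
  next
    case (Suc n)
    have IH: "g (r / 2) \<le> D" using Suc by (intro Suc.IH) auto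
    show ?case
    proof (cases "R \<le> r")
      case True
      have "g r powr (b + 1) \<le> C' * g (r / 2) powr b" by (rule rec[OF True])
      also have "\<dots> \<le> D * D powr b"
        using IH b(1) g0 D0 by (intro mult_mono powr_mono2) (auto simp: D_def)
      also have "\<dots> = D powr (b + 1)" using D0 by (simp add: powr_add)
      finally have "g r powr (b + 1) \<le> D powr (b + 1)" .
      moreover have "D powr (b + 1) < g r powr (b + 1)" if "D < g r"
        using that b(1) D0 by (intro powr_less_mono2) auto
      ultimately show ?thesis by (meson not_le)
    next
      case False
      moreover have "R * 1 \<le> R * 2 ^ n" using R by (intro mult_left_mono) auto
      ultimately have "r \<le> R * 2 ^ n" by simp
      then show ?thesis using Suc by auto
    qed
  qed
  moreover have "\<exists>n. r \<le> R * 2 ^ n" for r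
  proof -
    obtain n where "r / R < 2 ^ n" using real_arch_pow[of 2 "r / R"] by auto
    then show ?thesis using R by (intro exI[of _ n]) (simp add: field_simps)
  qed
  ultimately have "\<forall>r>0. g r \<le> D" by blast
  then show ?thesis unfolding g_def by blast
qed

end

section \<open>The equivalence\<close>

text \<open>In \<open>ereal\<close> an unbounded family has supremum infinity, so finiteness
  expresses boundedness; a supremum taken in the reals would not detect it.\<close>

lemma SUP_ereal_less_top_iff:
  fixes F :: "'a \<Rightarrow> real"
  shows "(SUP x. ereal (F x)) < \<infinity> \<longleftrightarrow> (\<exists>B. \<forall>x. F x \<le> B)"
proof
  assume *: "(SUP x. ereal (F x)) < \<infinity>"
  moreover have le: "ereal (F x) \<le> (SUP x. ereal (F x))" for x
    by (rule SUP_upper) simp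
  ultimately have "ereal (F x) \<le> ereal (real_of_ereal (SUP x. ereal (F x)))" for x
    using *[folded less_top] le[of x] by (cases "SUP x. ereal (F x)") simp_all
  then show "\<exists>B. \<forall>x. F x \<le> B" by auto
next
  assume "\<exists>B. \<forall>x. F x \<le> B"
  then obtain B where "\<And>x. F x \<le> B" by blast
  then have "(SUP x. ereal (F x)) \<le> ereal B" by (intro SUP_least) auto
  also have "\<dots> < \<infinity>" by simp
  finally show "(SUP x. ereal (F x)) < \<infinity>" .
qed

theorem theorem1p4:
  fixes \<alpha> \<epsilon> :: real and a :: "real \<Rightarrow> real" and \<mu> :: "real measure"
  assumes \<alpha>: "\<alpha> \<in> {1<..<2}"
    and a_pos: "\<And>x. 0 < a x"
    and a_cont: "continuous_on UNIV a"
    and a_int: "has_bochner_integral lborel (\<lambda>x. 1 / a x) 1"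
    and \<mu>: "\<mu> = speed_measure a"
    and \<epsilon>: "2 < \<epsilon>"
  shows "nash_inequality \<epsilon> \<mu> (dirichlet_form \<alpha>) (dirichlet_domain \<alpha> \<mu>) \<longleftrightarrow>
    (SUP x. ereal (\<bar>x\<bar> powr (\<alpha> - 1) * measure \<mu> (- {-\<bar>x\<bar><..<\<bar>x\<bar>}) powr ((\<epsilon> - 2) / \<epsilon>))) < \<infinity>"
proof -
  interpret nash_setting \<alpha> \<epsilon> a
    by unfold_locales (use assms in \<open>auto intro: borel_measurable_continuous_onI\<close>)
  have "(SUP x. ereal (\<bar>x\<bar> powr (\<alpha> - 1) * measure \<mu> (- {-\<bar>x\<bar><..<\<bar>x\<bar>}) powr ((\<epsilon> - 2) / \<epsilon>))) < \<infinity>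
    \<longleftrightarrow> (\<exists>B. \<forall>x. \<bar>x\<bar> powr (\<alpha> - 1) * tail \<bar>x\<bar> powr ((\<epsilon> - 2) / \<epsilon>) \<le> B)"
    unfolding SUP_ereal_less_top_iff tail_def \<mu> ..
  also have "\<dots> \<longleftrightarrow> (\<exists>B. \<forall>r>0. r powr (\<alpha> - 1) * tail r powr ((\<epsilon> - 2) / \<epsilon>) \<le> B)"
  proof
    assume "\<exists>B. \<forall>x. \<bar>x\<bar> powr (\<alpha> - 1) * tail \<bar>x\<bar> powr ((\<epsilon> - 2) / \<epsilon>) \<le> B"
    then show "\<exists>B. \<forall>r>0. r powr (\<alpha> - 1) * tail r powr ((\<epsilon> - 2) / \<epsilon>) \<le> B"
      by (metis abs_of_pos)
  next
    assume "\<exists>B. \<forall>r>0. r powr (\<alpha> - 1) * tail r powr ((\<epsilon> - 2) / \<epsilon>) \<le> B"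
    then obtain B where B: "\<And>r. 0 < r \<Longrightarrow> r powr (\<alpha> - 1) * tail r powr ((\<epsilon> - 2) / \<epsilon>) \<le> B" by blast
    \<comment> \<open>At \<open>x = 0\<close> the power of 0 vanishes; the maximum with 0 covers
      this value.\<close>
    have "\<bar>x\<bar> powr (\<alpha> - 1) * tail \<bar>x\<bar> powr ((\<epsilon> - 2) / \<epsilon>) \<le> max 0 B" for x
      using B[of "\<bar>x\<bar>"] by (cases "x = 0") (auto simp: le_max_iff_disj)
    then show "\<exists>B. \<forall>x. \<bar>x\<bar> powr (\<alpha> - 1) * tail \<bar>x\<bar> powr ((\<epsilon> - 2) / \<epsilon>) \<le> B" by blast
  qed
  also have "\<dots> \<longleftrightarrow> nash_inequality \<epsilon> \<mu> (dirichlet_form \<alpha>) (dirichlet_domain \<alpha> \<mu>)"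
    unfolding \<mu> using tail_bound_imp_nash nash_imp_tail_bound by blast
  finally show ?thesis ..
qed

end
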